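(* Let $x\in\mathcal{T}\mathrm{Gr}(2,n)$ and let $i\ne j$ be such that $x\in\mathcal{T}U_{ij}$. Let $T$ be a tree and $J$ a vanishing set such that $x\in\mathscr{C}^{(ij)}_{T,J}$, and let $\preceq$ be a partial order on $[n]\smallsetminus\{i,j\}$ having the cherry property on $T$ with respect to $i,j$. Then, for any index set $I$ compatible with $\preceq$ and $J(ij)$, and for any $\rho\in\mathrm{trop}^{-1}(x)$, $$\rho(f)\le\sigma^{(ij)}_{T,I,J}(x)(f)\qquad\text{for all } f\in R(ij).$$
   Context: $K$ is a field complete with respect to a non-Archimedean absolute value $|\cdot|$ (possibly trivial). Pairs $kl\in\binom{[n]}2$ are unordered. $\mathrm{Gr}(2,n)\subset\mathbb{P}_K^{\binom n2-1}$ is embedded by Plücker coordinates $p_{kl}$ ($p_{lk}=-p_{kl}$). For an affine $K$-scheme $\operatorname{Spec}B$ of finite type, $(\operatorname{Spec} B)^{\mathrm{an}}$ is the space of multiplicative seminorms on $B$ extending $|\cdot|$, with the topology of pointwise convergence; general analytifications are obtained by gluing. $\overline{\mathbb R}=\mathbb R\cup\{-\infty\}$, $\log0=-\infty$, $\exp(-\infty)=0$, $0\cdot(-\infty)=0$. $\mathbb{TP}^{N}=(\overline{\mathbb R}^{N+1}\smallsetminus\{(-\infty,\dots,-\infty)\})/\mathbb R\cdot(1,\dots,1)$. $\mathrm{trop}\colon\mathrm{Gr}(2,n)^{\mathrm{an}}\to\mathbb{TP}^{\binom n2-1}$ sends $\gamma$ over $\{p_{ij}\ne0\}$ to the class of $x$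 with $x_{kl}-x_{ij}=\log\gamma(p_{kl}/p_{ij})$; $\mathcal{T}\mathrm{Gr}(2,n)$ is its image. Cells: $U_{ij}=\{p_{ij}\ne0\}\subset\mathrm{Gr}(2,n)$ has coordinate ring the polynomial ring $R(ij)=K[u_{kl}:kl\in I(ij)]$, $u_{kl}=p_{kl}/p_{ij}$, $I(ij)=\{il,jl:l\ne i,j\}$; for $k,l\notin\{i,j\}$, $u_{kl}=u_{ik}u_{jl}-u_{il}u_{jk}\in R(ij)$. $\mathcal{T}U_{ij}=\{x\in\mathcal{T}\mathrm{Gr}(2,n):x_{ij}\ne-\infty\}$. For $x\in\mathcal{T}\mathrm{Gr}(2,n)$, $J(x)=\{kl:x_{kl}=-\infty\}$. Points of $\mathrm{trop}^{-1}(x)$ for $x\in\mathcal{T}U_{ij}$ are regarded as seminorms on $R(ij)$. Trees: a tree $T$ on $n$ leaves is a finite connected acyclic graph without degree-two vertices whose leaves are labeled bijectively by $[n]$; inner edges are those not ending in a leaf. $\mathscr{C}_T\subset\mathbb R^{\binom n2}/\mathbb R\cdot(1,\dots,1)\subset\mathbb{TP}^{\binom n2-1}$ is the set of classes of vectors $x$ for which there is $\omega\colon E(T)\to\mathbb R$, nonnegative on inner edges, with $x_{kl}$ the sum of $\omega(e)$ over the edges $e$ of the path from $k$ to $l$; $\overline{\mathscr C_T}$ is its closure in $\mathbb{TP}^{\binom n2-1}$. Given $i\ne j$, let $v_1,\dots,v_m$ be the internal vertices of the path from $i$ to $j$ in $T$, and let $T_a$ be the set of leaves $l\neq i,j$ whose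 path to the $i$–$j$ path first meets it at $v_a$. A vanishing set (for $i,j,T$) is a set of the form $J=J(x')$ with $x'\in\overline{\mathscr C_T}\cap\mathcal TU_{ij}$; put $J(ij)=J\cap I(ij)$. $\mathscr{C}^{(ij)}_{T,J}$ is the set of $x\in\overline{\mathscr C_T}\cap\mathcal{T}U_{ij}$ such that for all $kl\in I(ij)$: $x_{kl}=-\infty$ if and only if $kl\in J$. A quartet $\{a,b,c,d\}$ of $T$ is the subtree spanned by four leaves (degree-two vertices suppressed); a cherry is a pair of leaves adjacent to the same vertex. A partial order $\preceq$ on $[n]\smallsetminus\{i,j\}$ has the cherry property on $T$ with respect to $i,j$ if: leaves in different $T_a,T_b$ are incomparable; $\preceq$ is total on each $T_a$; and whenever $k\prec l\prec v$, either $\{k,l\}$ or $\{l,v\}$ is a cherry of the quartet $\{i,k,l,v\}$. A set $I\subset\binom{[n]}2$ of size $2(n-2)$ with $ij\notin I$ is compatible with $\preceq$ and $J(ij)$ if for each $a$ and each $k\in T_a$ exactly one of the following holds: (i) $ik,jk\in I$, and for all $l\prec k$ we have $il\in J(ij)$ or $jl\in J(ij)$; (ii) $ik\notin I$, $jl\in I$ for all $l\in T_a$, there is $t\prec k$ in $T_a$ with $it,jt\notin J(ij)$, and for the maximal such $t$, $kt\in I$; (iii) the same as (ii) with the roles of $i$ and $j$ exchanged. Let $H=I\cap I(ij)$. For such $I$ the elements $u_{kl}$, $kl\in I$, are algebraically independent over $K$ in the fraction field of $R(ij)$, and inside this field $R(ij)\subset K[u_{kl}:kl\in I][u_{kl}^{-1}:kl\in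 H\smallsetminus J]$. For $x\in\mathscr C^{(ij)}_{T,J}$, $\sigma^{(ij)}_{T,I,J}(x)\in U_{ij}^{\mathrm{an}}$ is the seminorm on $R(ij)$ obtained by restriction from the multiplicative seminorm $\sum_\alpha c_\alpha u^\alpha\mapsto\max_\alpha\{|c_\alpha|\exp(\sum_{kl\in I}\alpha_{kl}(x_{kl}-x_{ij}))\}$ on that ring. *)

theory Defs
  imports
    "HOL-Analysis.Analysis"
    "HOL-Library.Poly_Mapping"
    "HOL-Library.Uprod"
    "HOL-Computational_Algebra.Fraction_Field"
begin

section \<open>Pairs and the base field\<close>

text \<open>
  The lexicographic order below carries no mathematical content: a linear order on the
  indeterminates is what the \<^typ>\<open>('a, 'b) poly_mapping\<close> instance of class \<^class>\<open>idom\<close> asks for,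
  and hence what makes fraction fields of polynomial rings over \<^typ>\<open>nat uprod\<close> available.
\<close>

instantiation uprod :: (linorder) linorder
begin

definition less_eq_uprod :: "'a uprod \<Rightarrow> 'a uprod \<Rightarrow> bool" where
  "less_eq_uprod d e \<longleftrightarrow>
     Min (set_uprod d) < Min (set_uprod e) \<or>
     Min (set_uprod d) = Min (set_uprod e) \<and> Max (set_uprod d) \<le> Max (set_uprod e)"

definition less_uprod :: "'a uprod \<Rightarrow> 'a uprod \<Rightarrow> bool" where
  "less_uprod d e \<longleftrightarrow> d \<le> e \<and> \<not> e \<le> d"

instance
proof
  fix c d e :: "'a uprod"
  show "d < e \<longleftrightarrow> d \<le> e \<and> \<not> e \<le> d"
    by (rule less_uprod_def)
  show "d \<le> d"
    by (simp add: less_eq_uprod_def)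
  show "c \<le> e" if "c \<le> d" "d \<le> e"
    using that by (auto simp: less_eq_uprod_def)
  show "d = e" if "d \<le> e" "e \<le> d"
  proof -
    have "Min (set_uprod d) = Min (set_uprod e)" "Max (set_uprod d) = Max (set_uprod e)"
      using that by (auto simp: less_eq_uprod_def)
    then show ?thesis
      by (cases d; cases e) (auto simp: min_def max_def split: if_splits)
  qed
  show "d \<le> e \<or> e \<le> d"
    by (auto simp: less_eq_uprod_def)
qed

end

definition pairs :: "nat \<Rightarrow> nat uprod set" where
  "pairs n = {Upair k l | k l. k \<in> {1..n} \<and> l \<in> {1..n} \<and> k \<noteq> l}"

definition complete_nonarch_abs :: "('k::field \<Rightarrow> real) \<Rightarrow> bool" where
  "complete_nonarch_abs v \<longleftrightarrow>
     (\<forall>a. 0 \<le> v a) \<and> (\<forall>a. v a = 0 \<longleftrightarrow> a = 0) \<and>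
     (\<forall>a b. v (a * b) = v a * v b) \<and> (\<forall>a b. v (a + b) \<le> max (v a) (v b)) \<and>
     (\<forall>s :: nat \<Rightarrow> 'k. (\<forall>\<epsilon>>0. \<exists>N. \<forall>p\<ge>N. \<forall>q\<ge>N. v (s p - s q) < \<epsilon>) \<longrightarrow>
        (\<exists>a. (\<lambda>p. v (s p - a)) \<longlonglongrightarrow> 0))"


section \<open>The chart \<open>U\<^sub>i\<^sub>j\<close> of the Grassmannian and its analytification\<close>

type_synonym 'k pair_poly = "(nat uprod \<Rightarrow>\<^sub>0 nat) \<Rightarrow>\<^sub>0 'k"
type_synonym 'k pair_laurent = "(nat uprod \<Rightarrow>\<^sub>0 int) \<Rightarrow>\<^sub>0 'k"

definition pconst :: "'k::field \<Rightarrow> 'k pair_poly" where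
  "pconst c = Poly_Mapping.single 0 c"

definition pvar :: "nat uprod \<Rightarrow> 'k::field pair_poly" where
  "pvar e = Poly_Mapping.single (Poly_Mapping.single e 1) 1"

definition chart_pairs :: "nat \<Rightarrow> nat \<Rightarrow> nat \<Rightarrow> nat uprod set" where
  "chart_pairs n i j = {Upair i l | l. l \<in> {1..n} - {i, j}} \<union> {Upair j l | l. l \<in> {1..n} - {i, j}}"

definition chart_ring :: "nat \<Rightarrow> nat \<Rightarrow> nat \<Rightarrow> 'k::field pair_poly set" where
  "chart_ring n i j =
     {f. \<forall>m \<in> Poly_Mapping.keys f. Poly_Mapping.keys m \<subseteq> chart_pairs n i j}"

text \<open>
  The function \<open>u\<^sub>e = p\<^sub>e / p\<^sub>i\<^sub>j\<close> on the chart.  Since \<open>p\<^sub>l\<^sub>k = - p\<^sub>k\<^sub>l\<close>, it depends on an orientation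
  of \<open>e\<close>: the indeterminates are \<open>u\<^sub>i\<^sub>l\<close> and \<open>u\<^sub>j\<^sub>l\<close>, with \<open>i\<close> resp. \<open>j\<close> written first, and
  pairs disjoint from \<open>{i, j}\<close> are oriented increasingly.  Other choices change \<open>u\<^sub>e\<close> by a sign
  only, to which seminorms are insensitive.
\<close>

definition chart_coord :: "nat \<Rightarrow> nat \<Rightarrow> nat uprod \<Rightarrow> 'k::field pair_poly" where
  "chart_coord i j e =
     (let k = Min (set_uprod e); l = Max (set_uprod e) in
      if e = Upair i j then 1
      else if k \<in> {i, j} \<or> l \<in> {i, j} then pvar e
      else pvar (Upair i k) * pvar (Upair j l) - pvar (Upair i l) * pvar (Upair j k))"

text \<open>
  A point of \<open>U\<^sub>i\<^sub>j\<^sup>a\<^sup>n\<close>.  Only the values on \<^const>\<open>chart_ring\<close> matter; the values on polynomials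
  in other indeterminates are junk.
\<close>

definition chart_an :: "('k::field \<Rightarrow> real) \<Rightarrow> nat \<Rightarrow> nat \<Rightarrow> nat \<Rightarrow> ('k pair_poly \<Rightarrow> real) set" where
  "chart_an v n i j =
     {\<gamma>. (\<forall>f \<in> chart_ring n i j. 0 \<le> \<gamma> f) \<and>
         (\<forall>c. \<gamma> (pconst c) = v c) \<and>
         (\<forall>f \<in> chart_ring n i j. \<forall>g \<in> chart_ring n i j.
            \<gamma> (f * g) = \<gamma> f * \<gamma> g \<and> \<gamma> (f + g) \<le> \<gamma> f + \<gamma> g)}"


section \<open>Tropical projective space and the tropical Grassmannian\<close>

text \<open>
  Vectors with entries in \<open>\<real> \<union> {-\<infinity>}\<close> are \<^typ>\<open>ereal\<close>-valued functions avoiding \<open>\<infinity>\<close>; only their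
  values on \<^term>\<open>pairs n\<close> count.  A point of tropical projective space is the set of its
  homogeneous coordinate vectors, normalised to be extensional on \<^term>\<open>pairs n\<close>.
\<close>

definition trop_vectors :: "nat \<Rightarrow> (nat uprod \<Rightarrow> ereal) set" where
  "trop_vectors n =
     {x \<in> extensional (pairs n). (\<forall>e \<in> pairs n. x e \<noteq> \<infinity>) \<and> (\<exists>e \<in> pairs n. x e \<noteq> -\<infinity>)}"

definition trop_class :: "nat \<Rightarrow> (nat uprod \<Rightarrow> ereal) \<Rightarrow> (nat uprod \<Rightarrow> ereal) set" where
  "trop_class n x = {restrict (\<lambda>e. x e + ereal c) (pairs n) | c :: real. True}"

definition trop_proj :: "nat \<Rightarrow> (nat uprod \<Rightarrow> ereal) set set" where
  "trop_proj n = trop_class n ` trop_vectors n"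

text \<open>The quotient topology; \<open>\<Union>W\<close> is the preimage of \<open>W\<close> under \<open>x \<mapsto> trop_class n x\<close>.\<close>

definition trop_proj_topology :: "nat \<Rightarrow> (nat uprod \<Rightarrow> ereal) set topology" where
  "trop_proj_topology n = topology (\<lambda>W. W \<subseteq> trop_proj n \<and>
     openin (subtopology (product_topology (\<lambda>_. euclidean) (pairs n)) (trop_vectors n)) (\<Union>W))"

lemma trop_class_eq:
  assumes "y \<in> trop_class n x"
  shows "trop_class n y = trop_class n x"
proof -
  from assms obtain c where y: "y = restrict (\<lambda>e. x e + ereal c) (pairs n)"
    by (auto simp: trop_class_def)
  have "restrict (\<lambda>e. y e + ereal d) (pairs n) = restrict (\<lambda>e. x e + ereal (c + d)) (pairs n)" for d
    by (rule restrict_ext) (simp add: y add.assoc)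
  moreover have "restrict (\<lambda>e. x e + ereal d) (pairs n)
      = restrict (\<lambda>e. y e + ereal (d - c)) (pairs n)" for d
    by (rule restrict_ext) (simp add: y add.assoc)
  ultimately show ?thesis
    unfolding trop_class_def by blast
qed

lemma openin_trop_proj:
  "openin (trop_proj_topology n) W \<longleftrightarrow> W \<subseteq> trop_proj n \<and>
     openin (subtopology (product_topology (\<lambda>_. euclidean) (pairs n)) (trop_vectors n)) (\<Union>W)"
proof -
  let ?X = "subtopology (product_topology (\<lambda>_. euclidean :: ereal topology) (pairs n)) (trop_vectors n)"
  have int: "\<Union>(V \<inter> W) = \<Union>V \<inter> \<Union>W" if "V \<subseteq> trop_proj n" "W \<subseteq> trop_proj n" for V W
  proof -
    have "P = Q" if PQ: "P \<in> V" "Q \<in> W" and x: "x \<in> P" "x \<in> Q" for P Q x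
    proof -
      from PQ \<open>V \<subseteq> trop_proj n\<close> \<open>W \<subseteq> trop_proj n\<close>
      have "P \<in> trop_proj n" "Q \<in> trop_proj n" by blast+
      then obtain y z where "P = trop_class n y" "Q = trop_class n z"
        by (auto simp: trop_proj_def)
      with x show ?thesis
        using trop_class_eq by metis
    qed
    then show ?thesis by blast
  qed
  have "istopology (\<lambda>W. W \<subseteq> trop_proj n \<and> openin ?X (\<Union>W))"
    unfolding istopology_def
  proof (intro conjI allI impI)
    fix V W assume "V \<subseteq> trop_proj n \<and> openin ?X (\<Union>V)" "W \<subseteq> trop_proj n \<and> openin ?X (\<Union>W)"
    then have V: "V \<subseteq> trop_proj n" "openin ?X (\<Union>V)" and W: "W \<subseteq> trop_proj n" "openin ?X (\<Union>W)"
      by blast+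
    from V W show "V \<inter> W \<subseteq> trop_proj n" by blast
    show "openin ?X (\<Union>(V \<inter> W))"
      unfolding int[OF V(1) W(1)] using V(2) W(2) by (rule openin_Int)
  next
    fix \<V> assume *: "\<forall>V\<in>\<V>. V \<subseteq> trop_proj n \<and> openin ?X (\<Union>V)"
    then show "\<Union>\<V> \<subseteq> trop_proj n" by blast
    have "\<Union>(\<Union>\<V>) = \<Union>(Union ` \<V>)" by blast
    moreover have "openin ?X (\<Union>(Union ` \<V>))"
      using * by (intro openin_Union) blast
    ultimately show "openin ?X (\<Union>(\<Union>\<V>))" by (simp only:)
  qed
  from topology_inverse'[OF this] show ?thesis
    unfolding trop_proj_topology_def by (simp only:)
qed

definition elog :: "real \<Rightarrow> ereal" where
  "elog r = (if r = 0 then -\<infinity> else ereal (ln r))"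

definition eexp :: "ereal \<Rightarrow> real" where
  "eexp a = (if a = -\<infinity> then 0 else exp (real_of_ereal a))"

definition trop_map :: "nat \<Rightarrow> nat \<Rightarrow> nat \<Rightarrow> ('k::field pair_poly \<Rightarrow> real) \<Rightarrow> (nat uprod \<Rightarrow> ereal) set" where
  "trop_map n i j \<gamma> = trop_class n (\<lambda>e. elog (\<gamma> (chart_coord i j e)))"

text \<open>The charts cover the Grassmannian, so the image of \<open>trop\<close> is the union of the chart images.\<close>

definition trop_Gr :: "('k::field \<Rightarrow> real) \<Rightarrow> nat \<Rightarrow> (nat uprod \<Rightarrow> ereal) set set" where
  "trop_Gr v n = {trop_map n i j \<gamma> | i j \<gamma>.
     i \<in> {1..n} \<and> j \<in> {1..n} \<and> i \<noteq> j \<and> \<gamma> \<in> chart_an v n i j}"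

definition trop_U :: "('k::field \<Rightarrow> real) \<Rightarrow> nat \<Rightarrow> nat \<Rightarrow> nat \<Rightarrow> (nat uprod \<Rightarrow> ereal) set set" where
  "trop_U v n i j = {trop_class n x | x. trop_class n x \<in> trop_Gr v n \<and> x (Upair i j) \<noteq> -\<infinity>}"

text \<open>
  The fibre of \<open>trop\<close> over a point \<open>X\<close> of \<^term>\<open>trop_U v n i j\<close>.  As \<open>X\<^sub>i\<^sub>j \<noteq> -\<infinity>\<close>, the function \<open>p\<^sub>i\<^sub>j\<close>
  does not vanish at any point of the fibre, so that the fibre lies in \<open>U\<^sub>i\<^sub>j\<^sup>a\<^sup>n\<close>.
\<close>

definition trop_fibre ::
  "('k::field \<Rightarrow> real) \<Rightarrow> nat \<Rightarrow> nat \<Rightarrow> nat \<Rightarrow> (nat uprod \<Rightarrow> ereal) set \<Rightarrow> ('k pair_poly \<Rightarrow> real) set" where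
  "trop_fibre v n i j X = {\<gamma> \<in> chart_an v n i j. trop_map n i j \<gamma> = X}"

definition vanishing_pairs :: "nat \<Rightarrow> (nat uprod \<Rightarrow> ereal) \<Rightarrow> nat uprod set" where
  "vanishing_pairs n x = {e \<in> pairs n. x e = -\<infinity>}"


section \<open>Trees\<close>

record 'v ltree =
  tverts :: "'v set"
  tedges :: "'v uprod set"
  tleaf :: "nat \<Rightarrow> 'v"

definition tdegree :: "'v ltree \<Rightarrow> 'v \<Rightarrow> nat" where
  "tdegree T a = card {e \<in> tedges T. a \<in> set_uprod e}"

definition path_edges :: "'v list \<Rightarrow> 'v uprod set" where
  "path_edges p = {Upair (p ! s) (p ! Suc s) | s. Suc s < length p}"

definition is_path :: "'v ltree \<Rightarrow> 'v \<Rightarrow> 'v list \<Rightarrow> 'v \<Rightarrow> bool" where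
  "is_path T a p b \<longleftrightarrow> p \<noteq> [] \<and> hd p = a \<and> last p = b \<and> distinct p \<and>
     set p \<subseteq> tverts T \<and> path_edges p \<subseteq> tedges T"

definition is_cycle :: "'v ltree \<Rightarrow> 'v list \<Rightarrow> bool" where
  "is_cycle T p \<longleftrightarrow> 3 \<le> length p \<and> is_path T (hd p) p (last p) \<and> Upair (last p) (hd p) \<in> tedges T"

definition is_ltree :: "nat \<Rightarrow> 'v ltree \<Rightarrow> bool" where
  "is_ltree n T \<longleftrightarrow>
     finite (tverts T) \<and> tverts T \<noteq> {} \<and>
     (\<forall>e \<in> tedges T. proper_uprod e \<and> set_uprod e \<subseteq> tverts T) \<and>
     (\<forall>a \<in> tverts T. \<forall>b \<in> tverts T. \<exists>p. is_path T a p b) \<and>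
     (\<nexists>p. is_cycle T p) \<and>
     (\<forall>a \<in> tverts T. tdegree T a \<noteq> 2) \<and>
     bij_betw (tleaf T) {1..n} {a \<in> tverts T. tdegree T a = 1}"

definition inner_edges :: "'v ltree \<Rightarrow> 'v uprod set" where
  "inner_edges T = {e \<in> tedges T. \<forall>a \<in> set_uprod e. tdegree T a \<noteq> 1}"

definition tree_path :: "'v ltree \<Rightarrow> 'v \<Rightarrow> 'v \<Rightarrow> 'v list" where
  "tree_path T a b = (THE p. is_path T a p b)"

definition leaf_path :: "'v ltree \<Rightarrow> nat \<Rightarrow> nat \<Rightarrow> 'v list" where
  "leaf_path T k l = tree_path T (tleaf T k) (tleaf T l)"

definition tree_cone :: "nat \<Rightarrow> 'v ltree \<Rightarrow> (nat uprod \<Rightarrow> ereal) set set" where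
  "tree_cone n T = {trop_class n x | x. \<exists>\<omega> :: 'v uprod \<Rightarrow> real. (\<forall>e \<in> inner_edges T. 0 \<le> \<omega> e) \<and>
     (\<forall>k \<in> {1..n}. \<forall>l \<in> {1..n}. k \<noteq> l \<longrightarrow>
        x (Upair k l) = ereal (\<Sum>e \<in> path_edges (leaf_path T k l). \<omega> e))}"

definition tree_cone_closure :: "nat \<Rightarrow> 'v ltree \<Rightarrow> (nat uprod \<Rightarrow> ereal) set set" where
  "tree_cone_closure n T = trop_proj_topology n closure_of tree_cone n T"

text \<open>
  \<open>T\<^sub>a\<close> is indexed here by the vertex \<open>a\<close> itself, which ranges over the internal vertices of the
  path from \<open>i\<close> to \<open>j\<close>.
\<close>

definition internal_verts :: "'v ltree \<Rightarrow> nat \<Rightarrow> nat \<Rightarrow> 'v set" where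
  "internal_verts T i j = set (leaf_path T i j) - {tleaf T i, tleaf T j}"

definition branch :: "nat \<Rightarrow> 'v ltree \<Rightarrow> nat \<Rightarrow> nat \<Rightarrow> 'v \<Rightarrow> nat set" where
  "branch n T i j a =
     {l \<in> {1..n} - {i, j}. set (tree_path T (tleaf T l) a) \<inter> set (leaf_path T i j) = {a}}"

text \<open>
  \<open>subtree T Q\<close> is the subtree spanned by the leaves labelled by \<open>Q\<close>; \<open>suppress S T\<close> suppresses
  the vertices of degree two of the subtree \<open>S\<close> of \<open>T\<close>.
\<close>

definition subtree :: "'v ltree \<Rightarrow> nat set \<Rightarrow> 'v ltree" where
  "subtree T Q = \<lparr>tverts = (\<Union>k \<in> Q. \<Union>l \<in> Q. set (leaf_path T k l)),
                  tedges = (\<Union>k \<in> Q. \<Union>l \<in> Q. path_edges (leaf_path T k l)),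
                  tleaf = tleaf T\<rparr>"

definition suppress :: "'v ltree \<Rightarrow> 'v ltree" where
  "suppress S = \<lparr>tverts = {a \<in> tverts S. tdegree S a \<noteq> 2},
     tedges = {Upair a b | a b. a \<in> tverts S \<and> b \<in> tverts S \<and> a \<noteq> b \<and>
       tdegree S a \<noteq> 2 \<and> tdegree S b \<noteq> 2 \<and>
       (\<forall>c \<in> set (tree_path S a b) - {a, b}. tdegree S c = 2)},
     tleaf = tleaf S\<rparr>"

definition quartet :: "'v ltree \<Rightarrow> nat set \<Rightarrow> 'v ltree" where
  "quartet T Q = suppress (subtree T Q)"

definition is_cherry :: "'v ltree \<Rightarrow> nat \<Rightarrow> nat \<Rightarrow> bool" where
  "is_cherry T k l \<longleftrightarrow> k \<noteq> l \<and>
     (\<exists>a. Upair (tleaf T k) a \<in> tedges T \<and> Upair (tleaf T l) a \<in> tedges T)"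


section \<open>Strata, the cherry property and compatible index sets\<close>

definition vanishing_set ::
  "('k::field \<Rightarrow> real) \<Rightarrow> nat \<Rightarrow> 'v ltree \<Rightarrow> nat \<Rightarrow> nat \<Rightarrow> nat uprod set \<Rightarrow> bool" where
  "vanishing_set v n T i j J \<longleftrightarrow>
     (\<exists>x. trop_class n x \<in> tree_cone_closure n T \<inter> trop_U v n i j \<and> J = vanishing_pairs n x)"

definition stratum ::
  "('k::field \<Rightarrow> real) \<Rightarrow> nat \<Rightarrow> 'v ltree \<Rightarrow> nat \<Rightarrow> nat \<Rightarrow> nat uprod set \<Rightarrow> (nat uprod \<Rightarrow> ereal) set set" where
  "stratum v n T i j J = {trop_class n x | x.
     trop_class n x \<in> tree_cone_closure n T \<inter> trop_U v n i j \<and>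
     (\<forall>e \<in> chart_pairs n i j. x e = -\<infinity> \<longleftrightarrow> e \<in> J)}"

abbreviation strictly_below :: "nat rel \<Rightarrow> nat \<Rightarrow> nat \<Rightarrow> bool" where
  "strictly_below r k l \<equiv> (k, l) \<in> r \<and> k \<noteq> l"

definition cherry_property :: "nat \<Rightarrow> 'v ltree \<Rightarrow> nat \<Rightarrow> nat \<Rightarrow> nat rel \<Rightarrow> bool" where
  "cherry_property n T i j r \<longleftrightarrow>
     (\<forall>a \<in> internal_verts T i j. \<forall>b \<in> internal_verts T i j. a \<noteq> b \<longrightarrow>
        (\<forall>k \<in> branch n T i j a. \<forall>l \<in> branch n T i j b. (k, l) \<notin> r \<and> (l, k) \<notin> r)) \<and>
     (\<forall>a \<in> internal_verts T i j. total_on (branch n T i j a) r) \<and>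
     (\<forall>k l w. strictly_below r k l \<and> strictly_below r l w \<longrightarrow>
        is_cherry (quartet T {i, k, l, w}) k l \<or> is_cherry (quartet T {i, k, l, w}) l w)"

text \<open>
  For each \<open>k\<close> in a branch \<open>B\<close>, a compatible \<open>I\<close> either contains both \<open>ik\<close> and \<open>jk\<close>, or omits \<open>ik\<close>,
  or omits \<open>jk\<close>; the last case is \<open>compatible_omit\<close> with \<open>i\<close> and \<open>j\<close> exchanged.  \<open>Jij\<close> stands for
  \<open>J(ij) = J \<inter> I(ij)\<close>.
\<close>

definition compatible_both ::
  "nat \<Rightarrow> nat \<Rightarrow> nat rel \<Rightarrow> nat uprod set \<Rightarrow> nat uprod set \<Rightarrow> nat \<Rightarrow> bool" where
  "compatible_both i j r Jij I k \<longleftrightarrow> Upair i k \<in> I \<and> Upair j k \<in> I \<and>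
     (\<forall>l. strictly_below r l k \<longrightarrow> Upair i l \<in> Jij \<or> Upair j l \<in> Jij)"

definition compatible_omit ::
  "nat \<Rightarrow> nat \<Rightarrow> nat rel \<Rightarrow> nat uprod set \<Rightarrow> nat uprod set \<Rightarrow> nat set \<Rightarrow> nat \<Rightarrow> bool" where
  "compatible_omit i j r Jij I B k \<longleftrightarrow> Upair i k \<notin> I \<and> (\<forall>l \<in> B. Upair j l \<in> I) \<and>
     (let S = {t \<in> B. strictly_below r t k \<and> Upair i t \<notin> Jij \<and> Upair j t \<notin> Jij} in
      \<exists>t \<in> S. (\<forall>s \<in> S. \<not> strictly_below r t s) \<and> Upair k t \<in> I)"

definition compatible_set ::
  "nat \<Rightarrow> 'v ltree \<Rightarrow> nat \<Rightarrow> nat \<Rightarrow> nat rel \<Rightarrow> nat uprod set \<Rightarrow> nat uprod set \<Rightarrow> bool" where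
  "compatible_set n T i j r Jij I \<longleftrightarrow>
     I \<subseteq> pairs n \<and> card I = 2 * (n - 2) \<and> Upair i j \<notin> I \<and>
     (\<forall>a \<in> internal_verts T i j. \<forall>k \<in> branch n T i j a.
        let P = compatible_both i j r Jij I k;
            Q = compatible_omit i j r Jij I (branch n T i j a) k;
            R = compatible_omit j i r Jij I (branch n T i j a) k
        in (P \<and> \<not> Q \<and> \<not> R) \<or> (\<not> P \<and> Q \<and> \<not> R) \<or> (\<not> P \<and> \<not> Q \<and> R))"


section \<open>The section of the tropicalization\<close>

definition to_fract :: "'k::field pair_poly \<Rightarrow> 'k pair_poly fract" where
  "to_fract f = Fract f 1"

text \<open>The ring \<open>K[y\<^sub>e : e \<in> I][y\<^sub>e\<inverse> : e \<in> L]\<close> as Laurent polynomials in formal variables.\<close>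

definition laurent_ring :: "nat uprod set \<Rightarrow> nat uprod set \<Rightarrow> 'k::field pair_laurent set" where
  "laurent_ring I L = {g. \<forall>\<alpha> \<in> Poly_Mapping.keys g.
     Poly_Mapping.keys \<alpha> \<subseteq> I \<and> (\<forall>e. e \<notin> L \<longrightarrow> 0 \<le> Poly_Mapping.lookup \<alpha> e)}"

text \<open>Evaluation at \<open>y\<^sub>e = u\<^sub>e\<close> in the fraction field of the chart ring.\<close>

definition laurent_eval :: "nat \<Rightarrow> nat \<Rightarrow> 'k::field pair_laurent \<Rightarrow> 'k pair_poly fract" where
  "laurent_eval i j g =
     (\<Sum>\<alpha> \<in> Poly_Mapping.keys g. to_fract (pconst (Poly_Mapping.lookup g \<alpha>)) *
        (\<Prod>e \<in> Poly_Mapping.keys \<alpha>. to_fract (chart_coord i j e) powi Poly_Mapping.lookup \<alpha> e))"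

text \<open>The extra element \<open>0\<close> only serves to give the zero polynomial the value \<open>0\<close>.\<close>

definition gauss_seminorm ::
  "('k::field \<Rightarrow> real) \<Rightarrow> nat \<Rightarrow> nat \<Rightarrow> nat uprod set \<Rightarrow> (nat uprod \<Rightarrow> ereal) \<Rightarrow> 'k pair_laurent \<Rightarrow> real" where
  "gauss_seminorm v i j I x g = Max (insert 0
     ((\<lambda>\<alpha>. v (Poly_Mapping.lookup g \<alpha>) *
        eexp (\<Sum>e \<in> I. ereal (of_int (Poly_Mapping.lookup \<alpha> e)) * (x e - x (Upair i j)))) `
      Poly_Mapping.keys g))"

text \<open>
  For compatible \<open>I\<close> the \<open>u\<^sub>e\<close>, \<open>e \<in> I\<close>, are algebraically independent and the chart ring is contained
  in \<open>K[u\<^sub>e : e \<in> I][u\<^sub>e\<inverse> : e \<in> H - J]\<close>, so every \<open>f\<close> of the chart ring has exactly one Laurent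
  expansion \<open>g\<close>.
\<close>

definition chart_section ::
  "('k::field \<Rightarrow> real) \<Rightarrow> nat \<Rightarrow> nat \<Rightarrow> nat \<Rightarrow> nat uprod set \<Rightarrow> nat uprod set \<Rightarrow>
   (nat uprod \<Rightarrow> ereal) \<Rightarrow> 'k pair_poly \<Rightarrow> real" where
  "chart_section v n i j I J x f = gauss_seminorm v i j I x
     (THE g. g \<in> laurent_ring I (I \<inter> chart_pairs n i j - J) \<and> laurent_eval i j g = to_fract f)"

end

theory Submission
  imports Defs
begin

text \<open>
  The elements \<open>u\<^sub>e\<close>, \<open>e \<in> I\<close>, form a triangular system with respect to \<open>\<preceq>\<close>, so that the chart coordinates
  can be expressed recursively as Laurent polynomials in them.  This gives a ring homomorphism
  from \<open>R(ij)\<close> to the Laurent ring which inverts the evaluation map, hence existence and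
  uniqueness of the Laurent expansion \<open>g\<close> of \<open>f\<close>.  Multiplying \<open>g\<close> by a large monomial \<open>u\<^sup>N\<close> in
  the invertible \<open>u\<^sub>e\<close> turns it into a polynomial in elements of \<open>R(ij)\<close> equal to \<open>u\<^sup>N f\<close>.  The
  ultrametric inequality bounds \<open>\<rho>(u\<^sup>N f)\<close> by the largest term, and since \<open>\<rho>(u\<^sub>e)\<close> is
  prescribed by \<open>x\<close>, dividing by \<open>\<rho>(u\<^sup>N)\<close> gives the claim.
\<close>

section \<open>Paths in trees\<close>

text \<open>\<open>chart_section\<close> picks the expansion by \<open>THE\<close>, so uniqueness
  matters as much as existence. Both come from one substitution \<phi>: evaluation after
  \<open>psubst \<phi>\<close> is the identity on the chart ring, and \<open>psubst \<phi>\<close>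
  sends u_e with e in I to a formal variable. Triangularity rests on the Pluecker relation: up to
  sign, u_kt = u_ik u_jt - u_it u_jk is linear in whichever of u_ik, u_jk is omitted from I, and the
  coefficient of that unknown belongs to a leaf t below k. Compatibility only prescribes certain
  members of I at each k; that there are no others is a count, since the size 2(n - 2) leaves room
  for exactly two pairs per leaf. The delicate point is zero values: \<rho>(u_e) may vanish for e in
  J. Denominators are therefore confined to \<open>I \<inter> chart_pairs n i j - J\<close>, where
  x_e is finite, so that whatever is divided by has nonzero value.\<close>

lemma Upair_mem_swap: "Upair b a \<in> E \<longleftrightarrow> Upair a b \<in> E"
proof -
  have "Upair b a = Upair a b" by simp
  then show ?thesis by (rule arg_cong)
qed

lemma successively_edges_rev:
  "successively (\<lambda>a b. Upair a b \<in> E) (rev p) \<longleftrightarrow> successively (\<lambda>a b. Upair a b \<in> E) p"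
  unfolding successively_rev by (subst Upair_mem_swap) (rule refl)

lemma path_edges_subset_iff:
  "path_edges p \<subseteq> E \<longleftrightarrow> successively (\<lambda>a b. Upair a b \<in> E) p"
proof -
  have "path_edges p \<subseteq> E \<longleftrightarrow> (\<forall>s<length p - 1. Upair (p ! s) (p ! Suc s) \<in> E)"
    unfolding path_edges_def subset_iff less_diff_conv by auto
  also have "\<dots> \<longleftrightarrow> successively (\<lambda>a b. Upair a b \<in> E) p"
    by (induction p rule: induct_list012) (simp_all add: All_less_Suc2)
  finally show ?thesis .
qed

lemma is_path_iff:
  "is_path T a p b \<longleftrightarrow> p \<noteq> [] \<and> hd p = a \<and> last p = b \<and> distinct p \<and> set p \<subseteq> tverts T \<and>
     successively (\<lambda>a b. Upair a b \<in> tedges T) p"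
  by (simp add: is_path_def path_edges_subset_iff)

text \<open>Once induction has stripped the common initial part, the paths leave a in different
  directions. Following p to its first later vertex w on q and returning along q closes a
  cycle.\<close>

lemma is_path_unique:
  assumes acyclic: "\<nexists>p. is_cycle T p" and "is_path T a p b" "is_path T a q b"
  shows "p = q"
  using assms(2,3)
proof (induction "length p" arbitrary: a p q rule: less_induct)
  case less
  from less.prems obtain p' q' where p: "p = a # p'" and q: "q = a # q'"
    by (auto simp: is_path_iff neq_Nil_conv)
  show ?case
  proof (cases "p' = [] \<or> q' = []")
    case True
    with less.prems p q show ?thesis
      by (auto simp: is_path_iff split: if_splits)
  next
    case False
    then obtain c p'' d q'' where p': "p' = c # p''" and q': "q' = d # q''"
      by (auto simp: neq_Nil_conv)
    have P: "is_path T c p' b" and Q: "is_path T d q' b"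
      using less.prems p q p' q' by (auto simp: is_path_iff)
    show ?thesis
    proof (cases "c = d")
      case True
      with less.hyps[of p' c q'] P Q p q show ?thesis by simp
    next
      case False
      have "\<exists>w\<in>set p'. w \<in> set q'"
        using P Q by (metis is_path_iff last_in_set)
      from split_list_first_prop[OF this] obtain p1 w p2
        where p1: "p' = p1 @ w # p2" "w \<in> set q'" "\<forall>y\<in>set p1. y \<notin> set q'"
        by blast
      from p1(2) obtain q1 q2 where q1: "q' = q1 @ w # q2"
        by (meson split_list)
      define z where "z = (a # p1 @ [w]) @ rev q1"
      have eds: "successively (\<lambda>a b. Upair a b \<in> tedges T) (a # p1 @ w # p2)"
        "successively (\<lambda>a b. Upair a b \<in> tedges T) (a # q1 @ w # q2)"
        using less.prems p q p1(1) q1 by (auto simp: is_path_iff)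
      \<comment> \<open>If both pieces were empty, w would be the second vertex of p and of q at
        once. Hence \<open>z\<close> has at least three vertices.\<close>
      have ne: "p1 \<noteq> [] \<or> q1 \<noteq> []"
        using False p' q' p1(1) q1 by auto
      have "distinct z" "set z \<subseteq> tverts T"
        using less.prems unfolding p q p1(1) q1 is_path_iff z_def using p1(3) unfolding q1 by auto
      moreover have "successively (\<lambda>a b. Upair a b \<in> tedges T) z"
      proof -
        have "successively (\<lambda>a b. Upair a b \<in> tedges T) (rev (q1 @ [w]))"
          using eds(2) unfolding successively_edges_rev
          by (auto simp: successively_append_iff successively_Cons)
        moreover have "successively (\<lambda>a b. Upair a b \<in> tedges T) (a # p1) \<and>
            Upair (last (a # p1)) w \<in> tedges T"
          using eds(1) by (cases p1) (auto simp: successively_append_iff successively_Cons)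
        moreover have "z = (a # p1) @ rev (q1 @ [w])" by (simp add: z_def)
        ultimately show ?thesis by (simp only: successively_append_iff) simp
      qed
      moreover have "Upair (last z) (hd z) \<in> tedges T"
      proof -
        have "last z = hd (q1 @ [w])" by (cases q1) (simp_all add: z_def)
        moreover have "Upair (hd (q1 @ [w])) a \<in> tedges T"
          using eds(2) by (cases q1) (simp_all add: Upair_mem_swap)
        ultimately show ?thesis by (simp add: z_def)
      qed
      moreover have "3 \<le> length z"
        using ne unfolding z_def by (simp add: Suc_le_eq flip: length_greater_0_conv)
      moreover have "z \<noteq> []" by (simp add: z_def)
      ultimately have "is_cycle T z"
        by (simp add: is_cycle_def is_path_iff)
      with acyclic show ?thesis by blast
    qed
  qed
qed

lemma is_path_rev: "is_path T a p b \<Longrightarrow> is_path T b (rev p) a"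
  by (simp add: is_path_iff hd_rev last_rev successively_edges_rev del: successively_rev)

text \<open>A leaf has a single neighbour, and every nontrivial path to it arrives through that
  neighbour. This rules out an end of the i-j path as the place where a third leaf joins it.\<close>

lemma path_to_leaf_enters_earlier:
  assumes deg: "tdegree T b = 1" and "a \<noteq> b" "is_path T a p b" and "c \<noteq> b" "is_path T c q b"
  shows "\<exists>d \<in> set p \<inter> set q. d \<noteq> b"
proof -
  obtain p' where p: "p = p' @ [b]" "p' \<noteq> []" "b \<notin> set p'" "Upair (last p') b \<in> tedges T"
    using assms(2,3) by (cases p rule: rev_cases)
      (auto simp: is_path_iff successively_append_iff hd_append split: if_splits)
  obtain q' where q: "q = q' @ [b]" "q' \<noteq> []" "b \<notin> set q'" "Upair (last q') b \<in> tedges T"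
    using assms(4,5) by (cases q rule: rev_cases)
      (auto simp: is_path_iff successively_append_iff hd_append split: if_splits)
  obtain e where e: "{e \<in> tedges T. b \<in> set_uprod e} = {e}"
    using deg unfolding tdegree_def by (rule card_1_singletonE)
  have "Upair c b = e" if "Upair c b \<in> tedges T" for c
  proof -
    from that have "Upair c b \<in> {e \<in> tedges T. b \<in> set_uprod e}" by simp
    then show ?thesis unfolding e by simp
  qed
  with p(4) q(4) have "Upair (last p') b = Upair (last q') b" by metis
  then have "last p' = last q'" by auto
  moreover have "last p' \<in> set p'" "last q' \<in> set q'"
    using p(2) q(2) by simp_all
  ultimately show ?thesis
    using p(1,3) q(1) by (intro bexI[of _ "last p'"]) auto
qed

lemma tree_path_eq:
  assumes "is_ltree n T" "is_path T a p b"
  shows "tree_path T a b = p"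
  unfolding tree_path_def
proof (rule the_equality)
  show "q = p" if "is_path T a q b" for q
    using is_path_unique[OF _ that assms(2)] assms(1) by (simp add: is_ltree_def)
qed (fact assms(2))

text \<open>The conditions in \<open>compatible_set\<close> are imposed branch by branch; this makes
  them available for every k. The vertex a is the first one on the way from k to i that lies on the
  i-j path. It is no end of that path, since the neighbour of the end would be an earlier meeting
  point.\<close>

lemma branches_cover:
  assumes T: "is_ltree n T" and i: "i \<in> {1..n}" and j: "j \<in> {1..n}" and ij: "i \<noteq> j"
    and k: "k \<in> {1..n} - {i, j}"
  shows "\<exists>a \<in> internal_verts T i j. k \<in> branch n T i j a"
proof -
  have bij: "bij_betw (tleaf T) {1..n} {a \<in> tverts T. tdegree T a = 1}"
    and conn: "\<And>a b. a \<in> tverts T \<Longrightarrow> b \<in> tverts T \<Longrightarrow> \<exists>p. is_path T a p b"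
    using T by (simp_all add: is_ltree_def)
  have leaf: "tleaf T l \<in> tverts T" "tdegree T (tleaf T l) = 1" if "l \<in> {1..n}" for l
    using bij_betw_apply[OF bij that] by simp_all
  have inj: "tleaf T l \<noteq> tleaf T m" if "l \<in> {1..n}" "m \<in> {1..n}" "l \<noteq> m" for l m
    using bij_betw_imp_inj_on[OF bij] that by (meson inj_onD)
  obtain P where P: "is_path T (tleaf T i) P (tleaf T j)"
    using conn[OF leaf(1)[OF i] leaf(1)[OF j]] by blast
  obtain Q where Q: "is_path T (tleaf T k) Q (tleaf T i)"
    using conn[OF leaf(1) leaf(1)] i k by blast
  have "\<exists>a\<in>set Q. a \<in> set P"
  proof
    show "tleaf T i \<in> set Q" "tleaf T i \<in> set P"
      using P Q unfolding is_path_iff by (metis last_in_set, metis hd_in_set)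
  qed
  from split_list_first_prop[OF this] obtain q1 a q2
    where Q1: "Q = q1 @ a # q2" "a \<in> set P" "\<forall>b\<in>set q1. b \<notin> set P"
    by blast
  have Qa: "is_path T (tleaf T k) (q1 @ [a]) a"
    using Q unfolding Q1(1) is_path_iff
    by (simp add: successively_append_iff hd_append split: if_splits)
  have meet: "set (q1 @ [a]) \<inter> set P = {a}"
    using Q1 by auto
  have "tleaf T k \<noteq> tleaf T i" "tleaf T k \<noteq> tleaf T j" "tleaf T i \<noteq> tleaf T j"
    using inj[of k i] inj[of k j] inj[of i j] i j k ij by simp_all
  note ne = this this[symmetric]
  have "a \<noteq> tleaf T i"
  proof
    assume a: "a = tleaf T i"
    from path_to_leaf_enters_earlier[OF leaf(2)[OF i] ne(1) Qa[unfolded a] ne(6) is_path_rev[OF P]]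
    show False using meet a unfolding set_rev by blast
  qed
  moreover have "a \<noteq> tleaf T j"
  proof
    assume a: "a = tleaf T j"
    from path_to_leaf_enters_earlier[OF leaf(2)[OF j] ne(2) Qa[unfolded a] ne(3) P]
    show False using meet a by blast
  qed
  ultimately have "a \<in> internal_verts T i j"
    using Q1(2) by (simp add: internal_verts_def leaf_path_def tree_path_eq[OF T P])
  moreover have "k \<in> branch n T i j a"
    using k meet
    by (simp add: branch_def leaf_path_def tree_path_eq[OF T P] tree_path_eq[OF T Qa] del: set_append)
  ultimately show ?thesis by blast
qed

section \<open>Substitution into polynomials and Laurent polynomials\<close>

abbreviation keys where "keys \<equiv> Poly_Mapping.keys"
abbreviation lookup where "lookup \<equiv> Poly_Mapping.lookup"
abbreviation single where "single \<equiv> Poly_Mapping.single"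

text \<open>One set of transfer rules serves \<open>to_fract\<close>, \<open>pconst\<close>, their
  composite and \<open>psubst\<close>.\<close>

locale unital_hom =
  fixes h :: "'a::comm_ring_1 \<Rightarrow> 'b::comm_ring_1"
  assumes hom_one: "h 1 = 1"
    and hom_add: "h (a + b) = h a + h b"
    and hom_mult: "h (a * b) = h a * h b"
begin

lemma hom_zero: "h 0 = 0"
  using hom_add[of 0 0] by simp

lemma hom_uminus: "h (- a) = - h a"
  using hom_add[of a "- a"] by (simp add: hom_zero eq_neg_iff_add_eq_0 add.commute)

lemma hom_diff: "h (a - b) = h a - h b"
  using hom_add[of a "- b"] by (simp add: hom_uminus)

lemma hom_sum: "h (sum F A) = (\<Sum>x\<in>A. h (F x))"
  by (induction A rule: infinite_finite_induct) (simp_all add: hom_zero hom_add)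

lemma hom_prod: "h (prod F A) = (\<Prod>x\<in>A. h (F x))"
  by (induction A rule: infinite_finite_induct) (simp_all add: hom_one hom_mult)

lemma hom_power: "h (a ^ m) = h a ^ m"
  by (induction m) (simp_all add: hom_one hom_mult)

end

lemma unital_hom_single_0: "unital_hom (single 0 :: 'k::comm_ring_1 \<Rightarrow> ('g::comm_monoid_add \<Rightarrow>\<^sub>0 'k))"
  by unfold_locales (simp_all add: single_add mult_single)

lemma unital_hom_comp: "unital_hom g \<Longrightarrow> unital_hom h \<Longrightarrow> unital_hom (\<lambda>a. g (h a))"
  by (simp add: unital_hom_def)

interpretation to_fract: unital_hom to_fract
  by unfold_locales (simp_all add: to_fract_def One_fract_def)

lemma to_fract_eq_iff: "to_fract f = to_fract g \<longleftrightarrow> f = g"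
  by (simp add: to_fract_def eq_fract)

lemma to_fract_eq_0_iff: "to_fract f = 0 \<longleftrightarrow> f = 0"
  using to_fract_eq_iff[of f 0] by (simp add: to_fract.hom_zero)

lemma pconst_hom: "unital_hom pconst"
  unfolding pconst_def by (rule unital_hom_single_0)

interpretation pconst: unital_hom pconst
  by (rule pconst_hom)

text \<open>Linear extension of a map on exponents. Polynomial substitution and evaluation of
  Laurent polynomials both have this form, so additivity and multiplicativity are proved once for
  both.\<close>

definition lin_eval :: "('k::comm_ring_1 \<Rightarrow> 'r::comm_ring_1) \<Rightarrow> ('g \<Rightarrow> 'r) \<Rightarrow> ('g \<Rightarrow>\<^sub>0 'k) \<Rightarrow> 'r" where
  "lin_eval \<iota> M f = (\<Sum>a\<in>keys f. \<iota> (lookup f a) * M a)"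

lemma poly_mapping_eq_sum_single: "f = (\<Sum>a\<in>keys f. single a (lookup f a))"
proof (rule poly_mapping_eqI)
  fix b
  have "lookup (\<Sum>a\<in>keys f. single a (lookup f a)) b = (\<Sum>a\<in>keys f. if a = b then lookup f a else 0)"
    by (simp add: lookup_sum lookup_single when_def)
  also have "\<dots> = lookup f b"
    by (simp add: sum.delta' in_keys_iff)
  finally show "lookup f b = lookup (\<Sum>a\<in>keys f. single a (lookup f a)) b" ..
qed

context unital_hom
begin

lemma lin_eval_add: "lin_eval h M (f + g) = lin_eval h M f + lin_eval h M g"
  unfolding lin_eval_def
  by (rule setsum_keys_plus_distrib) (simp_all add: hom_zero hom_add distrib_right)

lemma lin_eval_single: "lin_eval h M (single a c) = h c * M a"
  by (cases "c = 0") (simp_all add: lin_eval_def hom_zero)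

lemma lin_eval_0: "lin_eval h M 0 = 0"
  by (simp add: lin_eval_def)

lemma lin_eval_sum: "lin_eval h M (sum F A) = (\<Sum>x\<in>A. lin_eval h M (F x))"
  by (induction A rule: infinite_finite_induct) (simp_all add: lin_eval_0 lin_eval_add)

text \<open>Multiplicativity of M is asked only on exponents that occur: with \<open>powi\<close> at
  base 0 it fails in general, as 0 powi (1 + (-1)) is 1 while the product of the two powers is
  0.\<close>

lemma lin_eval_mult:
  assumes "\<And>a b. a \<in> keys f \<Longrightarrow> b \<in> keys g \<Longrightarrow> M (a + b) = M a * M b"
  shows "lin_eval h M (f * g) = lin_eval h M f * lin_eval h M g"
proof -
  have "f * g = (\<Sum>a\<in>keys f. \<Sum>b\<in>keys g. single (a + b) (lookup f a * lookup g b))"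
    by (subst poly_mapping_eq_sum_single[of f], subst poly_mapping_eq_sum_single[of g])
      (simp add: sum_product mult_single)
  then have "lin_eval h M (f * g)
      = (\<Sum>a\<in>keys f. \<Sum>b\<in>keys g. h (lookup f a * lookup g b) * M (a + b))"
    by (simp add: lin_eval_sum lin_eval_single)
  also have "\<dots> = (\<Sum>a\<in>keys f. \<Sum>b\<in>keys g. (h (lookup f a) * M a) * (h (lookup g b) * M b))"
    by (intro sum.cong refl) (simp add: assms hom_mult mult_ac)
  also have "\<dots> = lin_eval h M f * lin_eval h M g"
    by (simp add: lin_eval_def sum_product)
  finally show ?thesis .
qed

end

lemma prod_keys_superset:
  assumes "finite S" "keys m \<subseteq> S" "\<And>e. p e 0 = 1"
  shows "(\<Prod>e\<in>keys m. p e (lookup m e)) = (\<Prod>e\<in>S. p e (lookup m e))"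
  using assms by (intro prod.mono_neutral_left) (auto simp: in_keys_iff)

text \<open>Integer exponents can cancel in m + m', so its keys may be fewer than the union; all
  three products are compared over that union. The function p covers natural and integer powers
  alike.\<close>

lemma prod_keys_add:
  fixes p :: "'e \<Rightarrow> 'b::comm_monoid_add \<Rightarrow> 'r::comm_monoid_mult"
  assumes p0: "\<And>e. p e 0 = 1"
    and p: "\<And>e. p e (lookup m e + lookup m' e) = p e (lookup m e) * p e (lookup m' e)"
  shows "(\<Prod>e\<in>keys (m + m'). p e (lookup (m + m') e))
    = (\<Prod>e\<in>keys m. p e (lookup m e)) * (\<Prod>e\<in>keys m'. p e (lookup m' e))"
proof -
  let ?S = "keys m \<union> keys m'"
  have "(\<Prod>e\<in>keys (m + m'). p e (lookup (m + m') e)) = (\<Prod>e\<in>?S. p e (lookup (m + m') e))"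
    using keys_add[of m m'] by (intro prod_keys_superset p0) simp_all
  also have "\<dots> = (\<Prod>e\<in>?S. p e (lookup m e)) * (\<Prod>e\<in>?S. p e (lookup m' e))"
    by (simp add: lookup_add p prod.distrib)
  also have "\<dots> = (\<Prod>e\<in>keys m. p e (lookup m e)) * (\<Prod>e\<in>keys m'. p e (lookup m' e))"
    by (simp add: prod_keys_superset[of ?S m p] prod_keys_superset[of ?S m' p] p0)
  finally show ?thesis .
qed

text \<open>The target is the ring of all Laurent polynomials, where every monomial is a unit;
  membership in \<open>laurent_ring\<close> is shown separately. In the end \<phi> e is the
  expansion of the chart coordinate e.\<close>

definition psubst :: "(nat uprod \<Rightarrow> 'k pair_laurent) \<Rightarrow> 'k::field pair_poly \<Rightarrow> 'k pair_laurent" where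
  "psubst \<phi> = lin_eval (single 0) (\<lambda>m. \<Prod>e\<in>keys m. \<phi> e ^ lookup m e)"

interpretation psubst: unital_hom "psubst \<phi>" for \<phi> :: "nat uprod \<Rightarrow> 'k::field pair_laurent"
proof -
  interpret c: unital_hom "single 0 :: 'k \<Rightarrow> 'k pair_laurent"
    by (rule unital_hom_single_0)
  show "unital_hom (psubst \<phi>)"
  proof
    show "psubst \<phi> 1 = 1"
      unfolding psubst_def single_one[symmetric] by (subst c.lin_eval_single) simp
    show "psubst \<phi> (a + b) = psubst \<phi> a + psubst \<phi> b" for a b
      unfolding psubst_def by (rule c.lin_eval_add)
    show "psubst \<phi> (a * b) = psubst \<phi> a * psubst \<phi> b" for a b
      unfolding psubst_def by (intro c.lin_eval_mult prod_keys_add) (simp_all add: power_add)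
  qed
qed

lemma psubst_pconst: "psubst \<phi> (pconst c) = single 0 c"
  by (simp add: psubst_def pconst_def unital_hom.lin_eval_single[OF unital_hom_single_0])

lemma psubst_pvar: "psubst \<phi> (pvar e) = \<phi> e"
  by (simp add: psubst_def pvar_def unital_hom.lin_eval_single[OF unital_hom_single_0])

lemma laurent_eval_eq_lin_eval:
  "laurent_eval i j = lin_eval (\<lambda>c. to_fract (pconst c))
     (\<lambda>\<alpha>. \<Prod>e\<in>keys \<alpha>. to_fract (chart_coord i j e) powi lookup \<alpha> e)"
  by (simp add: fun_eq_iff laurent_eval_def lin_eval_def)

interpretation fconst: unital_hom "\<lambda>c. to_fract (pconst c)"
  by (rule unital_hom_comp[OF to_fract.unital_hom_axioms pconst_hom])

lemma laurent_eval_add: "laurent_eval i j (f + g) = laurent_eval i j f + laurent_eval i j g"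
  unfolding laurent_eval_eq_lin_eval by (rule fconst.lin_eval_add)

lemma laurent_eval_const: "laurent_eval i j (single 0 c) = to_fract (pconst c)"
  unfolding laurent_eval_eq_lin_eval by (subst fconst.lin_eval_single) simp

lemma laurent_eval_var:
  "laurent_eval i j (single (single e k) 1) = to_fract (chart_coord i j e) powi k"
  unfolding laurent_eval_eq_lin_eval
  by (subst fconst.lin_eval_single) (simp add: fconst.hom_one)

lemma laurent_eval_mult:
  fixes f g :: "'k::field pair_laurent"
  assumes "f \<in> laurent_ring I L" "g \<in> laurent_ring I L"
    and L: "\<And>e. e \<in> L \<Longrightarrow> chart_coord i j e \<noteq> (0 :: 'k pair_poly)"
  shows "laurent_eval i j (f * g) = laurent_eval i j f * laurent_eval i j g"
  unfolding laurent_eval_eq_lin_eval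
proof (intro fconst.lin_eval_mult prod_keys_add)
  fix a b e assume "a \<in> keys f" "b \<in> keys g"
  with assms(1,2) have nonneg: "e \<in> L \<or> 0 \<le> lookup a e \<and> 0 \<le> lookup b e"
    unfolding laurent_ring_def by blast
  define u :: "'k pair_poly fract" where "u = to_fract (chart_coord i j e)"
  have "u powi (lookup a e + lookup b e) = u powi lookup a e * u powi lookup b e"
  proof (cases "e \<in> L")
    case True
    then have "u \<noteq> 0"
      using L[OF True] by (simp add: u_def to_fract_eq_0_iff)
    then show ?thesis by (simp add: power_int_add)
  next
    case False
    \<comment> \<open>At base 0 the power law needs a nonzero total exponent; two nonnegative
      exponents with sum 0 are both 0.\<close>
    with nonneg have "lookup a e + lookup b e \<noteq> 0 \<or> lookup a e = 0 \<and> lookup b e = 0"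
      by linarith
    then show ?thesis by (auto simp: power_int_add)
  qed
  then show "to_fract (chart_coord i j e) powi (lookup a e + lookup b e)
      = (to_fract (chart_coord i j e) powi lookup a e * to_fract (chart_coord i j e) powi lookup b e
         :: 'k pair_poly fract)"
    unfolding u_def .
qed simp_all

section \<open>Closure properties of the Laurent ring and the chart ring\<close>

lemma laurent_ring_add: "f \<in> laurent_ring I L \<Longrightarrow> g \<in> laurent_ring I L \<Longrightarrow> f + g \<in> laurent_ring I L"
  using keys_add[of f g] unfolding laurent_ring_def by blast

lemma laurent_ring_mult:
  assumes "f \<in> laurent_ring I L" "g \<in> laurent_ring I L"
  shows "f * g \<in> laurent_ring I L"
  unfolding laurent_ring_def
proof (intro CollectI ballI)
  fix \<alpha> assume "\<alpha> \<in> keys (f * g)"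
  then obtain a b where \<alpha>: "\<alpha> = a + b" and "a \<in> keys f" "b \<in> keys g"
    using keys_mult[of f g] by blast
  with assms have "keys a \<subseteq> I" "keys b \<subseteq> I"
    "\<And>e. e \<notin> L \<Longrightarrow> 0 \<le> lookup a e" "\<And>e. e \<notin> L \<Longrightarrow> 0 \<le> lookup b e"
    unfolding laurent_ring_def by blast+
  with keys_add[of a b] show "keys \<alpha> \<subseteq> I \<and> (\<forall>e. e \<notin> L \<longrightarrow> 0 \<le> lookup \<alpha> e)"
    unfolding \<alpha> lookup_add by (auto intro: add_nonneg_nonneg)
qed

lemma laurent_ring_const: "single 0 c \<in> laurent_ring I L"
  by (simp add: laurent_ring_def)

lemma laurent_ring_var: "e \<in> I \<Longrightarrow> 0 \<le> k \<or> e \<in> L \<Longrightarrow> single (single e k) 1 \<in> laurent_ring I L"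
  by (auto simp: laurent_ring_def lookup_single when_def)

lemma laurent_ring_uminus: "f \<in> laurent_ring I L \<Longrightarrow> - f \<in> laurent_ring I L"
  by (simp add: laurent_ring_def in_keys_iff)

lemma chart_ring_pconst: "pconst c \<in> chart_ring n i j"
  by (simp add: chart_ring_def pconst_def)

lemma chart_ring_pvar: "e \<in> chart_pairs n i j \<Longrightarrow> pvar e \<in> chart_ring n i j"
  by (simp add: chart_ring_def pvar_def)

lemma chart_ring_add: "f \<in> chart_ring n i j \<Longrightarrow> g \<in> chart_ring n i j \<Longrightarrow> f + g \<in> chart_ring n i j"
  using keys_add[of f g] unfolding chart_ring_def by blast

lemma chart_ring_mult:
  assumes "f \<in> chart_ring n i j" "g \<in> chart_ring n i j"
  shows "f * g \<in> chart_ring n i j"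
  unfolding chart_ring_def
proof (intro CollectI ballI)
  fix \<alpha> assume "\<alpha> \<in> keys (f * g)"
  then obtain a b where \<alpha>: "\<alpha> = a + b" and "a \<in> keys f" "b \<in> keys g"
    using keys_mult[of f g] by blast
  with assms have "keys a \<subseteq> chart_pairs n i j" "keys b \<subseteq> chart_pairs n i j"
    unfolding chart_ring_def by blast+
  with keys_add[of a b] show "keys \<alpha> \<subseteq> chart_pairs n i j"
    unfolding \<alpha> by blast
qed

lemma chart_ring_one: "1 \<in> chart_ring n i j"
  using chart_ring_pconst[of 1] by (simp add: pconst.hom_one)

lemma chart_ring_diff:
  assumes "f \<in> chart_ring n i j" "g \<in> chart_ring n i j"
  shows "f - g \<in> chart_ring n i j"
  using chart_ring_add[OF assms(1) chart_ring_mult[OF chart_ring_pconst[of "-1"] assms(2)]]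
  by (simp add: pconst.hom_uminus pconst.hom_one)

lemma chart_ring_power: "f \<in> chart_ring n i j \<Longrightarrow> f ^ m \<in> chart_ring n i j"
  by (induction m) (simp_all add: chart_ring_one chart_ring_mult)

lemma chart_ring_prod: "(\<And>x. x \<in> A \<Longrightarrow> F x \<in> chart_ring n i j) \<Longrightarrow> prod F A \<in> chart_ring n i j"
  by (induction A rule: infinite_finite_induct) (simp_all add: chart_ring_one chart_ring_mult)

lemma chart_ring_zero: "0 \<in> chart_ring n i j"
  by (simp add: chart_ring_def)

lemma chart_ring_sum: "(\<And>x. x \<in> A \<Longrightarrow> F x \<in> chart_ring n i j) \<Longrightarrow> sum F A \<in> chart_ring n i j"
  by (induction A rule: infinite_finite_induct) (simp_all add: chart_ring_zero chart_ring_add)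

lemma single_var_power: "single (single e 1) 1 ^ m = single (single e (of_nat m)) 1"
  by (induction m) (simp_all add: mult_single single_add)

lemma prod_single_var:
  "(\<Prod>e\<in>S. single (single e (k e)) 1) = single (\<Sum>e\<in>S. single e (k e)) 1"
  by (induction S rule: infinite_finite_induct) (simp_all add: mult_single)

lemma sum_single_lookup:
  assumes "finite S" "keys m \<subseteq> S"
  shows "(\<Sum>e\<in>S. single e (lookup m e)) = m"
proof -
  have "(\<Sum>e\<in>S. single e (lookup m e)) = (\<Sum>e\<in>keys m. single e (lookup m e))"
    using assms by (intro sum.mono_neutral_right) (auto simp: in_keys_iff)
  then show ?thesis using poly_mapping_eq_sum_single[of m] by simp
qed

lemma single_eq_pconst_prod: "single m c = pconst c * (\<Prod>e\<in>keys m. pvar e ^ lookup m e)"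
  by (simp add: pvar_def pconst_def single_var_power prod_single_var mult_single
    sum_single_lookup[OF finite_keys order_refl] del: One_nat_def)

text \<open>Reduces claims about substituted polynomials to the generators of the chart
  ring.\<close>

lemma chart_ring_induct [consumes 1, case_names const var add mult]:
  assumes f: "f \<in> chart_ring n i j"
    and const: "\<And>c. P (pconst c)"
    and var: "\<And>e. e \<in> chart_pairs n i j \<Longrightarrow> P (pvar e)"
    and add: "\<And>f g. P f \<Longrightarrow> P g \<Longrightarrow> P (f + g)"
    and mult: "\<And>f g. P f \<Longrightarrow> P g \<Longrightarrow> P (f * g)"
  shows "P f"
proof -
  have sum: "P (sum F A)" if "\<And>x. x \<in> A \<Longrightarrow> P (F x)" for F and A :: "(nat uprod \<Rightarrow>\<^sub>0 nat) set"
    using that const[of 0]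
    by (induction A rule: infinite_finite_induct) (simp_all add: pconst.hom_zero add)
  have prod: "P (prod F A)" if "\<And>x. x \<in> A \<Longrightarrow> P (F x)" for F and A :: "nat uprod set"
    using that const[of 1]
    by (induction A rule: infinite_finite_induct) (simp_all add: pconst.hom_one mult)
  have power: "P (g ^ m)" if "P g" for g m
    using that const[of 1] by (induction m) (simp_all add: pconst.hom_one mult)
  have "P (single m (lookup f m))" if "m \<in> keys f" for m
  proof -
    have "P (\<Prod>e\<in>keys m. pvar e ^ lookup m e)"
    proof (rule prod)
      fix e assume "e \<in> keys m"
      with f that have "e \<in> chart_pairs n i j" unfolding chart_ring_def by blast
      then show "P (pvar e ^ lookup m e)" by (rule power[OF var])
    qed
    from mult[OF const this] show ?thesis by (simp only: single_eq_pconst_prod)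
  qed
  then have "P (\<Sum>m\<in>keys f. single m (lookup f m))" by (rule sum)
  then show ?thesis using poly_mapping_eq_sum_single[of f] by simp
qed

section \<open>Laurent expansions of functions on the chart\<close>

text \<open>Used twice: a substitution is applied to the identity for uniqueness, a seminorm for the
  bound. The identity is checked in the fraction field and descends because \<open>to_fract\<close>
  is injective. Since N vanishes off L, the multiplier avoids coordinates that may have value
  0.\<close>

lemma laurent_numerator:
  fixes g :: "'k::field pair_laurent"
  assumes "finite I" and g: "g \<in> laurent_ring I L"
    and L: "\<And>e. e \<in> L \<Longrightarrow> chart_coord i j e \<noteq> (0 :: 'k pair_poly)"
    and eval: "laurent_eval i j g = to_fract f"
  shows "\<exists>N. (\<forall>e. e \<notin> L \<longrightarrow> N e = 0) \<and>
    (\<forall>\<alpha>\<in>keys g. \<forall>e. 0 \<le> lookup \<alpha> e + int (N e)) \<and>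
    (\<Sum>\<alpha>\<in>keys g. pconst (lookup g \<alpha>) * (\<Prod>e\<in>I. chart_coord i j e ^ nat (lookup \<alpha> e + int (N e))))
      = (\<Prod>e\<in>I. chart_coord i j e ^ N e) * f"
proof -
  \<comment> \<open>The sum of the pole orders, not their maximum: it still bounds each of them and
    needs no extra case for g = 0.\<close>
  define N where "N e = (\<Sum>\<alpha>\<in>keys g. nat (- lookup \<alpha> e))" for e
  define u :: "nat uprod \<Rightarrow> 'k pair_poly fract" where "u e = to_fract (chart_coord i j e)" for e
  have nonneg: "0 \<le> lookup \<alpha> e" if "\<alpha> \<in> keys g" "e \<notin> L" for \<alpha> e
    using g that unfolding laurent_ring_def by blast
  have N0: "N e = 0" if "e \<notin> L" for e
    using nonneg that by (simp add: N_def)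
  have N: "0 \<le> lookup \<alpha> e + int (N e)" if "\<alpha> \<in> keys g" for \<alpha> e
  proof -
    have "nat (- lookup \<alpha> e) \<le> N e"
      unfolding N_def using that by (intro member_le_sum) simp_all
    then show ?thesis by linarith
  qed
  have pow: "u e ^ nat (lookup \<alpha> e + int (N e)) = u e ^ N e * u e powi lookup \<alpha> e"
    if "\<alpha> \<in> keys g" for \<alpha> e
  proof (cases "e \<in> L")
    case True
    then have u: "u e \<noteq> 0"
      using L by (simp add: u_def to_fract_eq_0_iff)
    have "u e ^ nat (lookup \<alpha> e + int (N e)) = u e powi (lookup \<alpha> e + int (N e))"
      using N[OF that] by (simp add: power_int_def)
    also have "\<dots> = u e powi lookup \<alpha> e * u e powi int (N e)"
      using u by (simp add: power_int_add)
    finally show ?thesis by (simp add: mult.commute)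
  next
    case False
    then show ?thesis
      using nonneg[OF that False] by (simp add: N0 power_int_def)
  qed
  let ?p = "\<Sum>\<alpha>\<in>keys g. pconst (lookup g \<alpha>) * (\<Prod>e\<in>I. chart_coord i j e ^ nat (lookup \<alpha> e + int (N e)))"
  have "to_fract ?p = (\<Sum>\<alpha>\<in>keys g. to_fract (pconst (lookup g \<alpha>)) *
      (\<Prod>e\<in>I. u e ^ nat (lookup \<alpha> e + int (N e))))"
    by (simp add: to_fract.hom_sum to_fract.hom_mult to_fract.hom_prod to_fract.hom_power u_def)
  also have "\<dots> = (\<Sum>\<alpha>\<in>keys g. (\<Prod>e\<in>I. u e ^ N e) * (to_fract (pconst (lookup g \<alpha>)) *
      (\<Prod>e\<in>keys \<alpha>. u e powi lookup \<alpha> e)))"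
  proof (rule sum.cong[OF refl])
    fix \<alpha> assume \<alpha>: "\<alpha> \<in> keys g"
    then have "keys \<alpha> \<subseteq> I" using g unfolding laurent_ring_def by blast
    then have "(\<Prod>e\<in>keys \<alpha>. u e powi lookup \<alpha> e) = (\<Prod>e\<in>I. u e powi lookup \<alpha> e)"
      using \<open>finite I\<close> by (intro prod_keys_superset) simp_all
    then show "to_fract (pconst (lookup g \<alpha>)) * (\<Prod>e\<in>I. u e ^ nat (lookup \<alpha> e + int (N e)))
      = (\<Prod>e\<in>I. u e ^ N e) * (to_fract (pconst (lookup g \<alpha>)) * (\<Prod>e\<in>keys \<alpha>. u e powi lookup \<alpha> e))"
      by (simp add: pow[OF \<alpha>] prod.distrib mult_ac)
  qed
  also have "\<dots> = (\<Prod>e\<in>I. u e ^ N e) * laurent_eval i j g"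
    by (simp add: laurent_eval_def sum_distrib_left u_def)
  also have "\<dots> = to_fract ((\<Prod>e\<in>I. chart_coord i j e ^ N e) * f)"
    by (simp add: eval to_fract.hom_mult to_fract.hom_prod to_fract.hom_power u_def)
  finally show ?thesis
    using N0 N by (intro exI[of _ N] conjI) (simp_all add: to_fract_eq_iff)
qed

text \<open>Under \<open>psubst \<phi>\<close> the numerator identity becomes an equation between g
  and \<open>psubst \<phi> f\<close>, each multiplied by the monomial with exponent \<nu>. That
  monomial is a unit and cancels.\<close>

lemma laurent_expansion_unique:
  fixes g :: "'k::field pair_laurent"
  assumes "finite I" and g: "g \<in> laurent_ring I L"
    and L: "\<And>e. e \<in> L \<Longrightarrow> chart_coord i j e \<noteq> (0 :: 'k pair_poly)"
    and eval: "laurent_eval i j g = to_fract f"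
    and \<phi>: "\<And>e. e \<in> I \<Longrightarrow> psubst \<phi> (chart_coord i j e) = single (single e 1) 1"
  shows "g = psubst \<phi> f"
proof -
  obtain N :: "nat uprod \<Rightarrow> nat" where
    nonneg: "\<forall>\<alpha>\<in>keys g. \<forall>e. 0 \<le> lookup \<alpha> e + int (N e)" and
    eq: "(\<Sum>\<alpha>\<in>keys g. pconst (lookup g \<alpha>) * (\<Prod>e\<in>I. chart_coord i j e ^ nat (lookup \<alpha> e + int (N e))))
      = (\<Prod>e\<in>I. chart_coord i j e ^ N e) * f"
    using laurent_numerator[OF assms(1-4)] by blast
  define \<nu> where "\<nu> = (\<Sum>e\<in>I. single e (int (N e)))"
  have monom: "psubst \<phi> (\<Prod>e\<in>I. chart_coord i j e ^ k e) = single (\<Sum>e\<in>I. single e (int (k e))) 1" for k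
  proof -
    have "psubst \<phi> (\<Prod>e\<in>I. chart_coord i j e ^ k e) = (\<Prod>e\<in>I. (single (single e 1) 1) ^ k e)"
      unfolding psubst.hom_prod psubst.hom_power by (rule prod.cong) (simp_all only: \<phi>)
    then show ?thesis by (simp add: single_var_power prod_single_var del: One_nat_def)
  qed
  have "single \<nu> 1 * g = (\<Sum>\<alpha>\<in>keys g. single (\<nu> + \<alpha>) (lookup g \<alpha>))"
    using arg_cong[OF poly_mapping_eq_sum_single[of g], of "(*) (single \<nu> 1)"]
    by (simp add: sum_distrib_left mult_single)
  also have "\<dots> = (\<Sum>\<alpha>\<in>keys g. single 0 (lookup g \<alpha>) *
      psubst \<phi> (\<Prod>e\<in>I. chart_coord i j e ^ nat (lookup \<alpha> e + int (N e))))"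
  proof (rule sum.cong[OF refl])
    fix \<alpha> assume \<alpha>: "\<alpha> \<in> keys g"
    then have "keys \<alpha> \<subseteq> I" using g unfolding laurent_ring_def by blast
    then have "(\<Sum>e\<in>I. single e (lookup \<alpha> e)) = \<alpha>"
      using \<open>finite I\<close> by (rule sum_single_lookup[rotated])
    then show "single (\<nu> + \<alpha>) (lookup g \<alpha>) = single 0 (lookup g \<alpha>) *
      psubst \<phi> (\<Prod>e\<in>I. chart_coord i j e ^ nat (lookup \<alpha> e + int (N e)))"
      unfolding monom using nonneg \<alpha>
      by (simp add: mult_single \<nu>_def single_add sum.distrib add.commute)
  qed
  also have "\<dots> = psubst \<phi> (\<Sum>\<alpha>\<in>keys g. pconst (lookup g \<alpha>) *
      (\<Prod>e\<in>I. chart_coord i j e ^ nat (lookup \<alpha> e + int (N e))))"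
    by (simp add: psubst.hom_sum psubst.hom_mult psubst_pconst)
  also have "\<dots> = single \<nu> 1 * psubst \<phi> f"
    unfolding eq by (simp add: psubst.hom_mult monom \<nu>_def)
  finally have "single (- \<nu>) 1 * (single \<nu> 1 * g) = single (- \<nu>) 1 * (single \<nu> 1 * psubst \<phi> f)"
    by simp
  then show ?thesis
    by (simp add: mult.assoc[symmetric] mult_single)
qed

section \<open>Chart coordinates and their recursive inversion\<close>

lemma chart_coord_left: "k \<notin> {i, j} \<Longrightarrow> chart_coord i j (Upair i k) = pvar (Upair i k)"
  by (auto simp: chart_coord_def Let_def min_def max_def)

lemma chart_coord_right: "k \<notin> {i, j} \<Longrightarrow> chart_coord i j (Upair j k) = pvar (Upair j k)"
  by (auto simp: chart_coord_def Let_def min_def max_def)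

lemma chart_coord_off:
  assumes "k \<notin> {i, j}" "t \<notin> {i, j}" "k \<noteq> t"
  shows "chart_coord i j (Upair k t) = (if k < t then 1 else - 1) *
    (pvar (Upair i k) * pvar (Upair j t) - pvar (Upair i t) * pvar (Upair j k))"
  using assms by (auto simp: chart_coord_def Let_def min_def max_def)

lemma pvar_nonzero: "pvar e \<noteq> 0"
  by (metis lookup_single_eq lookup_zero one_neq_zero pvar_def)

lemma laurent_ring_one: "1 \<in> laurent_ring I L"
  by (simp add: laurent_ring_def)

text \<open>If \<open>ik\<close> is omitted from \<open>I\<close>, then \<open>u\<^sub>i\<^sub>k = (u\<^sub>k\<^sub>t + u\<^sub>i\<^sub>t u\<^sub>j\<^sub>k) / u\<^sub>j\<^sub>t\<close> up to the sign of \<open>u\<^sub>k\<^sub>t\<close>,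
  where \<open>u\<^sub>i\<^sub>t\<close> has already been expressed through the \<open>u\<^sub>e\<close>, \<open>e \<in> I\<close>, because \<open>t\<close> precedes \<open>k\<close>.\<close>

lemma chart_inverse_exists:
  fixes n i j :: nat and I L :: "nat uprod set" and R :: "nat rel"
  defines "N \<equiv> {1..n} - {i, j}"
  assumes ij: "i \<noteq> j" and "wf R" and LI: "L \<subseteq> I" and Lc: "L \<subseteq> chart_pairs n i j"
    and step: "\<And>k. k \<in> N \<Longrightarrow>
      Upair i k \<in> I \<and> Upair j k \<in> I \<and> (\<forall>t\<in>N. (t, k) \<in> R \<longrightarrow> Upair k t \<notin> I) \<or>
      Upair i k \<notin> I \<and> Upair j k \<in> I \<and>
        (\<exists>t\<in>N. (t, k) \<in> R \<and> Upair k t \<in> I \<and> Upair j t \<in> L \<and>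
          (\<forall>s\<in>N. (s, k) \<in> R \<longrightarrow> Upair k s \<in> I \<longrightarrow> s = t)) \<or>
      Upair j k \<notin> I \<and> Upair i k \<in> I \<and>
        (\<exists>t\<in>N. (t, k) \<in> R \<and> Upair k t \<in> I \<and> Upair i t \<in> L \<and>
          (\<forall>s\<in>N. (s, k) \<in> R \<longrightarrow> Upair k s \<in> I \<longrightarrow> s = t))"
    and I: "\<And>e. e \<in> I \<Longrightarrow> (\<exists>k\<in>N. e = Upair i k \<or> e = Upair j k) \<or>
      (\<exists>k\<in>N. \<exists>t\<in>N. (t, k) \<in> R \<and> e = Upair k t)"
  shows "\<exists>\<phi> :: nat uprod \<Rightarrow> 'k::field pair_laurent.
    (\<forall>e\<in>chart_pairs n i j. \<phi> e \<in> laurent_ring I L \<and> laurent_eval i j (\<phi> e) = to_fract (pvar e)) \<and>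
    (\<forall>e\<in>I. psubst \<phi> (chart_coord i j e) = single (single e 1) 1)"
proof -
  define Y :: "nat uprod \<Rightarrow> int \<Rightarrow> 'k pair_laurent" where "Y e k = single (single e k) 1" for e k
  \<comment> \<open>\<open>chart_coord\<close> orients kt increasingly; this sign converts it to the
    orientation with k first.\<close>
  define sg :: "nat \<Rightarrow> nat \<Rightarrow> 'k pair_laurent" where "sg k t = (if k < t then 1 else - 1)" for k t
  define F :: "nat uprod \<Rightarrow> 'k pair_poly fract" where "F e = to_fract (pvar e)" for e
  let ?ev = "laurent_eval i j :: 'k pair_laurent \<Rightarrow> _"
  let ?LR = "laurent_ring I L :: 'k pair_laurent set"
  have N: "k \<notin> {i, j}" if "k \<in> N" for k
    using that by (simp add: N_def)
  have Rneq: "t \<noteq> k" if "(t, k) \<in> R" for t k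
    using \<open>wf R\<close> that by auto
  have F0: "F e \<noteq> 0" for e
    by (simp add: F_def to_fract_eq_0_iff pvar_nonzero)
  have cc: "chart_coord i j (Upair i k) = pvar (Upair i k)"
    "chart_coord i j (Upair j k) = pvar (Upair j k)" if "k \<in> N" for k
    using chart_coord_left[OF N[OF that]] chart_coord_right[OF N[OF that]] by simp_all
  have L0: "chart_coord i j e \<noteq> (0 :: 'k pair_poly)" if "e \<in> L" for e
  proof -
    from that Lc obtain k where "k \<in> N" "e = Upair i k \<or> e = Upair j k"
      unfolding chart_pairs_def N_def by blast
    then show ?thesis using cc pvar_nonzero by metis
  qed
  have ev_mult: "?ev (a * b) = ?ev a * ?ev b" if "a \<in> ?LR" "b \<in> ?LR" for a b
    using that L0 by (rule laurent_eval_mult)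
  have Y_LR: "Y e 1 \<in> ?LR" if "e \<in> I" for e
    using that by (simp add: Y_def laurent_ring_var)
  have Yinv_LR: "Y e (- 1) \<in> ?LR" if "e \<in> L" for e
    using that LI by (auto simp: Y_def intro: laurent_ring_var)
  have Yinv: "Y e 1 * Y e (- 1) = 1" for e
    by (simp add: Y_def mult_single single_add[symmetric])
  have sg_LR: "sg k t \<in> ?LR" for k t
    by (simp add: sg_def laurent_ring_one laurent_ring_uminus)
  have sg_sq: "sg k t * sg k t = 1" for k t
    by (simp add: sg_def)
  have evY: "?ev (Y (Upair i k) 1) = F (Upair i k)" "?ev (Y (Upair j k) 1) = F (Upair j k)"
    "?ev (Y (Upair i k) (- 1)) = inverse (F (Upair i k))"
    "?ev (Y (Upair j k) (- 1)) = inverse (F (Upair j k))" if "k \<in> N" for k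
    using that by (simp_all add: Y_def F_def laurent_eval_var cc power_int_minus)
  have ev_sgY: "?ev (sg k t * Y (Upair k t) 1)
      = F (Upair i k) * F (Upair j t) - F (Upair i t) * F (Upair j k)"
    if "k \<in> N" "t \<in> N" "k \<noteq> t" "Upair k t \<in> I" for k t
  proof -
    have 1: "?ev (sg k t) = (if k < t then 1 else - 1)"
      using laurent_eval_const[of i j "1::'k"] laurent_eval_const[of i j "-1::'k"]
      by (simp add: sg_def fconst.hom_one fconst.hom_uminus single_uminus)
    have "?ev (sg k t * Y (Upair k t) 1) = ?ev (sg k t) * to_fract (chart_coord i j (Upair k t))"
      using ev_mult[OF sg_LR Y_LR[OF that(4)]] by (simp add: Y_def laurent_eval_var)
    also have "\<dots> = F (Upair i k) * F (Upair j t) - F (Upair i t) * F (Upair j k)"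
      unfolding 1 chart_coord_off[OF N[OF that(1)] N[OF that(2)] that(3)]
      by (simp add: F_def to_fract.hom_one to_fract.hom_mult to_fract.hom_diff to_fract.hom_uminus)
    finally show ?thesis .
  qed
  \<comment> \<open>The pair p holds the expansions of u_ik and u_jk. The last clause is the
    Pluecker relation with each t below k such that kt is in I; it yields the value of
    \<open>psubst \<phi>\<close> on u_kt.\<close>
  define P where "P f k p \<longleftrightarrow> (k \<in> N \<longrightarrow> fst p \<in> ?LR \<and> snd p \<in> ?LR \<and>
      ?ev (fst p) = F (Upair i k) \<and> ?ev (snd p) = F (Upair j k) \<and>
      (Upair i k \<in> I \<longrightarrow> fst p = Y (Upair i k) 1) \<and> (Upair j k \<in> I \<longrightarrow> snd p = Y (Upair j k) 1) \<and>
      (\<forall>t\<in>N. (t, k) \<in> R \<longrightarrow> Upair k t \<in> I \<longrightarrow>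
        sg k t * (fst p * snd (f t) - fst (f t) * snd p) = Y (Upair k t) 1))"
    for f :: "nat \<Rightarrow> 'k pair_laurent \<times> 'k pair_laurent" and k p
  have "\<exists>f. \<forall>k. P f k (f k)"
  proof (rule dependent_wf_choice[OF \<open>wf R\<close>])
    show "P f k p = P g k p" if "\<And>z. (z, k) \<in> R \<Longrightarrow> f z = g z" for f g k p
      unfolding P_def by (simp add: that)
  next
    fix k f assume IH: "P f t (f t)" if "(t, k) \<in> R" for t
    show "\<exists>p. P f k p"
    proof (cases "k \<in> N")
      case False
      then show ?thesis by (simp add: P_def)
    next
      case k: True
      have IH': "fst (f t) \<in> ?LR" "snd (f t) \<in> ?LR"
        "?ev (fst (f t)) = F (Upair i t)" "?ev (snd (f t)) = F (Upair j t)"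
        "Upair i t \<in> I \<Longrightarrow> fst (f t) = Y (Upair i t) 1" "Upair j t \<in> I \<Longrightarrow> snd (f t) = Y (Upair j t) 1"
        if "(t, k) \<in> R" "t \<in> N" for t
        using IH[OF that(1)] that(2) by (simp_all add: P_def)
      from step[OF k] consider
          (both) "Upair i k \<in> I" "Upair j k \<in> I" "\<forall>t\<in>N. (t, k) \<in> R \<longrightarrow> Upair k t \<notin> I"
        | (omit_i) t where "Upair i k \<notin> I" "Upair j k \<in> I" "t \<in> N" "(t, k) \<in> R" "Upair k t \<in> I"
            "Upair j t \<in> L" "\<forall>s\<in>N. (s, k) \<in> R \<longrightarrow> Upair k s \<in> I \<longrightarrow> s = t"
        | (omit_j) t where "Upair j k \<notin> I" "Upair i k \<in> I" "t \<in> N" "(t, k) \<in> R" "Upair k t \<in> I"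
            "Upair i t \<in> L" "\<forall>s\<in>N. (s, k) \<in> R \<longrightarrow> Upair k s \<in> I \<longrightarrow> s = t"
        by blast
      then show ?thesis
      proof cases
        case both
        then have "P f k (Y (Upair i k) 1, Y (Upair j k) 1)"
          using k by (simp add: P_def Y_LR evY)
        then show ?thesis by blast
      next
        case omit_i
        \<comment> \<open>The Pluecker relation solved for u_ik u_jt; dividing by u_jt is permitted
          because jt is in L.\<close>
        define w where "w = sg k t * Y (Upair k t) 1 + fst (f t) * Y (Upair j k) 1"
        define a where "a = w * Y (Upair j t) (- 1)"
        note IHt = IH'[OF omit_i(4,3)]
        have kt: "k \<noteq> t" using Rneq[OF omit_i(4)] by simp
        have w_LR: "w \<in> ?LR"
          unfolding w_def by (intro laurent_ring_add laurent_ring_mult sg_LR Y_LR IHt omit_i)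
        then have a_LR: "a \<in> ?LR"
          unfolding a_def by (intro laurent_ring_mult Yinv_LR omit_i)
        have "?ev w = F (Upair i k) * F (Upair j t)"
          unfolding w_def laurent_eval_add ev_sgY[OF k omit_i(3) kt omit_i(5)]
            ev_mult[OF IHt(1) Y_LR[OF omit_i(2)]]
          by (simp add: IHt(3) evY[OF k])
        then have ev_a: "?ev a = F (Upair i k)"
          unfolding a_def ev_mult[OF w_LR Yinv_LR[OF omit_i(6)]]
          by (simp add: evY[OF omit_i(3)] F0)
        have "snd (f t) = Y (Upair j t) 1"
          using IHt(6) omit_i(6) LI by blast
        then have "a * snd (f t) = w * (Y (Upair j t) 1 * Y (Upair j t) (- 1))"
          by (simp add: a_def mult_ac)
        then have "sg k t * (a * snd (f t) - fst (f t) * Y (Upair j k) 1)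
            = (sg k t * sg k t) * Y (Upair k t) 1"
          by (simp add: Yinv w_def mult.assoc)
        then have rel: "sg k t * (a * snd (f t) - fst (f t) * Y (Upair j k) 1) = Y (Upair k t) 1"
          by (simp add: sg_sq)
        \<comment> \<open>Only one t below k has kt in I, so the relation that defined
          \<open>a\<close> is the only one to verify.\<close>
        have "sg k s * (a * snd (f s) - fst (f s) * Y (Upair j k) 1) = Y (Upair k s) 1"
          if "s \<in> N" "(s, k) \<in> R" "Upair k s \<in> I" for s
        proof -
          have "s = t" using omit_i(7) that by blast
          then show ?thesis using rel by simp
        qed
        then have "P f k (a, Y (Upair j k) 1)"
          unfolding P_def fst_conv snd_conv
          using omit_i(1) a_LR ev_a Y_LR[OF omit_i(2)] evY(2)[OF k] by blast
        then show ?thesis by blast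
      next
        case omit_j
        define w where "w = Y (Upair i k) 1 * snd (f t) - sg k t * Y (Upair k t) 1"
        define b where "b = w * Y (Upair i t) (- 1)"
        note IHt = IH'[OF omit_j(4,3)]
        have kt: "k \<noteq> t" using Rneq[OF omit_j(4)] by simp
        \<comment> \<open>Evaluation rules are at hand for sums and products, so the difference is
          written with a factor -1.\<close>
        have w_eq: "w = Y (Upair i k) 1 * snd (f t) + - 1 * (sg k t * Y (Upair k t) 1)"
          by (simp add: w_def)
        have m1: "- 1 \<in> ?LR"
          by (simp add: laurent_ring_one laurent_ring_uminus)
        have ev_m1: "?ev (- 1) = - 1"
          using laurent_eval_const[of i j "-1::'k"]
          by (simp add: fconst.hom_one fconst.hom_uminus single_uminus)
        have z: "sg k t * Y (Upair k t) 1 \<in> ?LR"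
          by (intro laurent_ring_mult sg_LR Y_LR omit_j)
        have w_LR: "w \<in> ?LR"
          unfolding w_eq by (intro laurent_ring_add laurent_ring_mult m1 sg_LR Y_LR IHt omit_j)
        then have b_LR: "b \<in> ?LR"
          unfolding b_def by (intro laurent_ring_mult Yinv_LR omit_j)
        have "?ev w = F (Upair i t) * F (Upair j k)"
          unfolding w_eq laurent_eval_add ev_mult[OF m1 z] ev_m1
            ev_mult[OF Y_LR[OF omit_j(2)] IHt(2)] ev_sgY[OF k omit_j(3) kt omit_j(5)]
          by (simp add: IHt(4) evY[OF k])
        then have ev_b: "?ev b = F (Upair j k)"
          unfolding b_def ev_mult[OF w_LR Yinv_LR[OF omit_j(6)]]
          by (simp add: evY[OF omit_j(3)] F0)
        have "fst (f t) = Y (Upair i t) 1"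
          using IHt(5) omit_j(6) LI by blast
        then have "fst (f t) * b = w * (Y (Upair i t) 1 * Y (Upair i t) (- 1))"
          by (simp add: b_def mult_ac)
        then have "sg k t * (Y (Upair i k) 1 * snd (f t) - fst (f t) * b)
            = (sg k t * sg k t) * Y (Upair k t) 1"
          by (simp add: Yinv w_def mult.assoc)
        then have rel: "sg k t * (Y (Upair i k) 1 * snd (f t) - fst (f t) * b) = Y (Upair k t) 1"
          by (simp add: sg_sq)
        have "sg k s * (Y (Upair i k) 1 * snd (f s) - fst (f s) * b) = Y (Upair k s) 1"
          if "s \<in> N" "(s, k) \<in> R" "Upair k s \<in> I" for s
        proof -
          have "s = t" using omit_j(7) that by blast
          then show ?thesis using rel by simp
        qed
        then have "P f k (Y (Upair i k) 1, b)"
          unfolding P_def fst_conv snd_conv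
          using omit_j(1) b_LR ev_b Y_LR[OF omit_j(2)] evY(1)[OF k] by blast
        then show ?thesis by blast
      qed
    qed
  qed
  then obtain f where f: "P f k (f k)" for k by blast
  \<comment> \<open>A chart pair contains exactly one of i and j, and \<open>THE\<close> recovers
    its other leaf. The pair ij falls into the first case but is not a chart pair.\<close>
  define \<phi> where "\<phi> e = (if \<exists>k. e = Upair i k then fst (f (THE k. e = Upair i k))
    else snd (f (THE k. e = Upair j k)))" for e
  have other: "(THE m. Upair l k = Upair l m) = k" for k l :: nat
    by (rule the_equality) auto
  have \<phi>i: "\<phi> (Upair i k) = fst (f k)" for k
    unfolding \<phi>_def other by (rule if_P) blast
  have \<phi>j: "\<phi> (Upair j k) = snd (f k)" if "k \<in> N" for k
    unfolding \<phi>_def other using ij N[OF that] by (intro if_not_P) auto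
  show ?thesis
  proof (intro exI[of _ \<phi>] conjI ballI)
    fix e assume "e \<in> chart_pairs n i j"
    then obtain k where k: "k \<in> N" "e = Upair i k \<or> e = Upair j k"
      unfolding chart_pairs_def N_def by blast
    with f[of k] show "\<phi> e \<in> laurent_ring I L" "laurent_eval i j (\<phi> e) = to_fract (pvar e)"
      by (auto simp: P_def \<phi>i \<phi>j F_def)
  next
    fix e assume e: "e \<in> I"
    from I[OF e] show "psubst \<phi> (chart_coord i j e) = single (single e 1) 1"
    proof (elim disjE bexE conjE)
      fix k assume k: "k \<in> N" and "e = Upair i k"
      with e f[of k] show ?thesis by (simp add: cc psubst_pvar \<phi>i P_def Y_def)
    next
      fix k assume k: "k \<in> N" and "e = Upair j k"
      with e f[of k] show ?thesis by (simp add: cc psubst_pvar \<phi>j P_def Y_def)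
    next
      fix k t assume k: "k \<in> N" and t: "t \<in> N" and R: "(t, k) \<in> R" and e': "e = Upair k t"
      have "psubst \<phi> (if k < t then 1 else - 1) = sg k t"
        by (simp add: sg_def psubst.hom_one psubst.hom_uminus)
      then have "psubst \<phi> (chart_coord i j e) = sg k t * (fst (f k) * snd (f t) - fst (f t) * snd (f k))"
        unfolding e' chart_coord_off[OF N[OF k] N[OF t] Rneq[OF R, symmetric]]
        by (simp add: psubst.hom_mult psubst.hom_diff psubst_pvar \<phi>i \<phi>j k t del: if_distrib)
      then show ?thesis using f[of k] k t R e unfolding P_def e' Y_def by simp
    qed
  qed
qed

section \<open>Points of the analytic chart\<close>

lemma chart_coord_in_chart_ring:
  assumes "i \<in> {1..n}" "j \<in> {1..n}" "e \<in> pairs n"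
  shows "chart_coord i j e \<in> (chart_ring n i j :: 'k::field pair_poly set)"
proof (cases "e = Upair i j")
  case True
  then show ?thesis by (simp add: chart_coord_def chart_ring_one)
next
  case False
  from assms(3) obtain k l where e: "e = Upair k l" "k \<in> {1..n}" "l \<in> {1..n}" "k \<noteq> l"
    unfolding pairs_def by blast
  have var: "pvar (Upair i m) \<in> (chart_ring n i j :: 'k pair_poly set)"
    "pvar (Upair j m) \<in> (chart_ring n i j :: 'k pair_poly set)"
    if "m \<in> {1..n}" "m \<notin> {i, j}" for m
    using that by (auto simp: chart_pairs_def intro!: chart_ring_pvar)
  show ?thesis
  proof (cases "k \<in> {i, j} \<or> l \<in> {i, j}")
    case True
    then obtain m where m: "m \<in> {1..n}" "m \<notin> {i, j}" "e = Upair i m \<or> e = Upair j m"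
      using e False by (cases "k \<in> {i, j}") auto
    then show ?thesis
      using var by (auto simp: chart_coord_left chart_coord_right)
  next
    case False
    then have kl: "k \<notin> {i, j}" "l \<notin> {i, j}" by auto
    have D: "pvar (Upair i k) * pvar (Upair j l) - pvar (Upair i l) * pvar (Upair j k)
        \<in> (chart_ring n i j :: 'k pair_poly set)"
      by (intro chart_ring_diff chart_ring_mult var e(2,3) kl)
    show ?thesis
      unfolding e(1) chart_coord_off[OF kl e(4)]
      using D chart_ring_diff[OF chart_ring_zero D] by simp
  qed
qed

section \<open>Seminorms on the chart ring: ultrametric inequality and Laurent bound\<close>

lemma nonarch_abs_of_nat:
  assumes "complete_nonarch_abs v"
  shows "v (of_nat m) \<le> 1" and "v 1 = 1"
proof -
  have v0: "v 0 = 0" and v1: "v 1 \<noteq> 0" and "v (1 * 1) = v 1 * v 1"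
    and ult: "\<And>a b. v (a + b) \<le> max (v a) (v b)"
    using assms unfolding complete_nonarch_abs_def by (metis one_neq_zero)+
  then show one: "v 1 = 1" by simp
  show "v (of_nat m) \<le> 1"
  proof (induction m)
    case (Suc m)
    then show ?case using ult[of 1 "of_nat m"] one by simp
  qed (simp add: v0)
qed

text \<open>If t > m, then (N + 1)(m/t)^N is at least 1 for all N, yet tends to 0 because a
  geometric sequence beats linear growth.\<close>

lemma le_of_forall_power_le:
  fixes t m :: real
  assumes "0 \<le> m" and le: "\<And>N. t ^ N \<le> real (Suc N) * m ^ N"
  shows "t \<le> m"
proof (rule ccontr)
  assume "\<not> t \<le> m"
  then have t: "0 < t" and s: "norm (m / t) < 1"
    using assms(1) by auto
  have "1 \<le> real N * (m / t) ^ N + (m / t) ^ N" for N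
  proof -
    have "1 \<le> real (Suc N) * m ^ N / t ^ N"
      using le[of N] t by simp
    then show ?thesis by (simp add: power_divide algebra_simps add_divide_distrib)
  qed
  moreover have "(\<lambda>N. real N * (m / t) ^ N + (m / t) ^ N) \<longlonglongrightarrow> 0 + 0"
    using s by (intro tendsto_add powser_times_n_limit_0 LIMSEQ_power_zero)
  ultimately have "1 \<le> (0 :: real) + 0"
    by (intro LIMSEQ_le_const[where X = "\<lambda>N. real N * (m / t) ^ N + (m / t) ^ N"]) auto
  then show False by simp
qed

locale chart_seminorm =
  fixes v :: "'k::field \<Rightarrow> real" and n i j :: nat and \<rho> :: "'k pair_poly \<Rightarrow> real"
  assumes v: "complete_nonarch_abs v" and \<rho>: "\<rho> \<in> chart_an v n i j"
begin

lemma nonneg: "f \<in> chart_ring n i j \<Longrightarrow> 0 \<le> \<rho> f"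
  using \<rho> unfolding chart_an_def by blast

lemma mult: "f \<in> chart_ring n i j \<Longrightarrow> g \<in> chart_ring n i j \<Longrightarrow> \<rho> (f * g) = \<rho> f * \<rho> g"
  using \<rho> unfolding chart_an_def by blast

lemma triangle: "f \<in> chart_ring n i j \<Longrightarrow> g \<in> chart_ring n i j \<Longrightarrow> \<rho> (f + g) \<le> \<rho> f + \<rho> g"
  using \<rho> unfolding chart_an_def by blast

lemma const: "\<rho> (pconst c) = v c"
  using \<rho> unfolding chart_an_def by blast

lemma one: "\<rho> 1 = 1"
  using const[of 1] nonarch_abs_of_nat(2)[OF v] by (simp add: pconst.hom_one)

lemma zero: "\<rho> 0 = 0"
proof -
  have "v 0 = 0" using v unfolding complete_nonarch_abs_def by blast
  then show ?thesis using const[of 0] by (simp add: pconst.hom_zero)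
qed

lemma power: "f \<in> chart_ring n i j \<Longrightarrow> \<rho> (f ^ m) = \<rho> f ^ m"
  by (induction m) (simp_all add: one mult chart_ring_power)

lemma prod: "(\<And>x. x \<in> A \<Longrightarrow> F x \<in> chart_ring n i j) \<Longrightarrow> \<rho> (prod F A) = (\<Prod>x\<in>A. \<rho> (F x))"
  by (induction A rule: infinite_finite_induct) (simp_all add: one mult chart_ring_prod)

lemma sum_le: "(\<And>x. x \<in> A \<Longrightarrow> F x \<in> chart_ring n i j) \<Longrightarrow> \<rho> (sum F A) \<le> (\<Sum>x\<in>A. \<rho> (F x))"
proof (induction A rule: infinite_finite_induct)
  case (insert x A)
  have "\<rho> (F x + sum F A) \<le> \<rho> (F x) + \<rho> (sum F A)"
    using insert.prems by (intro triangle chart_ring_sum) simp_all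
  also have "\<rho> (sum F A) \<le> (\<Sum>x\<in>A. \<rho> (F x))"
    using insert by simp
  finally show ?case using insert.hyps by simp
qed (simp_all add: zero)

text \<open>The definition of \<^const>\<open>chart_an\<close> only asks for the triangle inequality.  The ultrametric
  one follows because the binomial coefficients in \<open>(f + g)\<^sup>N\<close> have absolute value at most \<open>1\<close>,
  by letting \<open>N\<close> tend to infinity.\<close>

lemma ultrametric:
  assumes f: "f \<in> chart_ring n i j" and g: "g \<in> chart_ring n i j"
  shows "\<rho> (f + g) \<le> max (\<rho> f) (\<rho> g)"
proof (rule le_of_forall_power_le)
  show "0 \<le> max (\<rho> f) (\<rho> g)" using nonneg[OF f] by simp
next
  fix N
  let ?m = "max (\<rho> f) (\<rho> g)"
  have of_nat_eq: "(of_nat q :: 'k pair_poly) = pconst (of_nat q)" for q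
    by (simp add: pconst_def)
  have mem: "of_nat (N choose k) * f ^ k * g ^ (N - k) \<in> chart_ring n i j" for k
    unfolding of_nat_eq by (intro chart_ring_mult chart_ring_power chart_ring_pconst f g)
  have "\<rho> (f + g) ^ N = \<rho> (\<Sum>k\<le>N. of_nat (N choose k) * f ^ k * g ^ (N - k))"
    using power[OF chart_ring_add[OF f g], of N] by (simp add: binomial_ring)
  also have "\<dots> \<le> (\<Sum>k\<le>N. \<rho> (of_nat (N choose k) * f ^ k * g ^ (N - k)))"
    by (rule sum_le) (rule mem)
  also have "\<dots> \<le> (\<Sum>k\<le>N. ?m ^ N)"
  proof (rule sum_mono)
    fix k assume "k \<in> {..N}"
    then have k: "k + (N - k) = N" by simp
    have "\<rho> (of_nat (N choose k) * f ^ k * g ^ (N - k))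
        = v (of_nat (N choose k)) * \<rho> f ^ k * \<rho> g ^ (N - k)"
      unfolding of_nat_eq
      by (simp add: mult chart_ring_mult chart_ring_power chart_ring_pconst f g power const)
    also have "\<dots> \<le> 1 * ?m ^ k * ?m ^ (N - k)"
      using nonneg[OF f] nonneg[OF g] nonarch_abs_of_nat(1)[OF v]
      by (intro mult_mono power_mono mult_nonneg_nonneg zero_le_power) auto
    also have "\<dots> = ?m ^ N"
      by (simp add: k flip: power_add)
    finally show "\<rho> (of_nat (N choose k) * f ^ k * g ^ (N - k)) \<le> ?m ^ N" .
  qed
  \<comment> \<open>The factor \<open>Suc N\<close> counts the terms of the binomial
    expansion.\<close>
  finally show "\<rho> (f + g) ^ N \<le> real (Suc N) * ?m ^ N" by simp
qed

lemma sum_le_bound: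
  assumes "\<And>x. x \<in> A \<Longrightarrow> F x \<in> chart_ring n i j" "\<And>x. x \<in> A \<Longrightarrow> \<rho> (F x) \<le> B" "0 \<le> B"
  shows "\<rho> (sum F A) \<le> B"
  using assms
proof (induction A rule: infinite_finite_induct)
  case (insert x A)
  have "\<rho> (F x + sum F A) \<le> max (\<rho> (F x)) (\<rho> (sum F A))"
    using insert.prems by (intro ultrametric chart_ring_sum) simp_all
  also have "\<dots> \<le> B" using insert by simp
  finally show ?case using insert.hyps by simp
qed (simp_all add: zero)

text \<open>The condition on L makes the value q of the multiplier positive, hence cancellable,
  although other \<rho>(u_e) may be 0. With an abstract bound B the argument stays within the reals;
  extended logarithms enter only when the Gauss seminorm is inserted.\<close>

lemma le_laurent_bound:
  assumes "finite I" and "g \<in> laurent_ring I L" and f: "f \<in> chart_ring n i j"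
    and "laurent_eval i j g = to_fract f"
    and mem: "\<And>e. e \<in> I \<Longrightarrow> chart_coord i j e \<in> (chart_ring n i j :: 'k pair_poly set)"
    and L: "\<And>e. e \<in> L \<Longrightarrow> \<rho> (chart_coord i j e) \<noteq> 0"
    and B: "\<And>\<alpha>. \<alpha> \<in> keys g \<Longrightarrow>
      v (lookup g \<alpha>) * (\<Prod>e\<in>I. \<rho> (chart_coord i j e) powi lookup \<alpha> e) \<le> B" "0 \<le> B"
  shows "\<rho> f \<le> B"
proof -
  define w where "w e = \<rho> (chart_coord i j e)" for e
  have "chart_coord i j e \<noteq> (0 :: 'k pair_poly)" if "e \<in> L" for e
    using L[OF that] zero by auto
  from laurent_numerator[OF assms(1,2) this assms(4)] obtain N :: "nat uprod \<Rightarrow> nat" where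
    N0: "\<forall>e. e \<notin> L \<longrightarrow> N e = 0" and
    N: "\<forall>\<alpha>\<in>keys g. \<forall>e. 0 \<le> lookup \<alpha> e + int (N e)" and
    eq: "(\<Sum>\<alpha>\<in>keys g. pconst (lookup g \<alpha>) * (\<Prod>e\<in>I. chart_coord i j e ^ nat (lookup \<alpha> e + int (N e))))
      = (\<Prod>e\<in>I. chart_coord i j e ^ N e) * f"
    by blast
  define q where "q = (\<Prod>e\<in>I. w e ^ N e)"
  have w0: "0 \<le> w e" if "e \<in> I" for e
    using nonneg[OF mem[OF that]] by (simp add: w_def)
  have q: "0 < q"
    unfolding q_def
  proof (rule prod_pos)
    fix e assume e: "e \<in> I"
    show "0 < w e ^ N e"
    proof (cases "e \<in> L")
      case True
      then have "w e \<noteq> 0" using L by (simp add: w_def)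
      with w0[OF e] show ?thesis by simp
    qed (simp add: N0)
  qed
  have "\<rho> ((\<Prod>e\<in>I. chart_coord i j e ^ N e) * f) = \<rho> (\<Prod>e\<in>I. chart_coord i j e ^ N e) * \<rho> f"
    by (intro mult chart_ring_prod chart_ring_power mem f)
  also have "\<rho> (\<Prod>e\<in>I. chart_coord i j e ^ N e) = q"
    by (simp add: prod chart_ring_power mem power q_def w_def)
  finally have qf: "\<rho> ((\<Prod>e\<in>I. chart_coord i j e ^ N e) * f) = q * \<rho> f" .
  have "q * \<rho> f \<le> q * B"
    unfolding qf[symmetric] eq[symmetric]
  proof (rule sum_le_bound)
    fix \<alpha> assume \<alpha>: "\<alpha> \<in> keys g"
    show "pconst (lookup g \<alpha>) * (\<Prod>e\<in>I. chart_coord i j e ^ nat (lookup \<alpha> e + int (N e)))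
        \<in> chart_ring n i j"
      by (intro chart_ring_mult chart_ring_pconst chart_ring_prod chart_ring_power mem)
    have pow: "w e ^ nat (lookup \<alpha> e + int (N e)) = w e ^ N e * w e powi lookup \<alpha> e" for e
    proof (cases "e \<in> L")
      case True
      then have w: "w e \<noteq> 0" using L by (simp add: w_def)
      have "w e ^ nat (lookup \<alpha> e + int (N e)) = w e powi (lookup \<alpha> e + int (N e))"
        using N \<alpha> by (simp add: power_int_def)
      also have "\<dots> = w e powi lookup \<alpha> e * w e powi int (N e)"
        using w by (simp add: power_int_add)
      finally show ?thesis by (simp add: mult.commute)
    next
      case False
      then have "N e = 0" "0 \<le> lookup \<alpha> e"
        using N0 assms(2) \<alpha> unfolding laurent_ring_def by blast+
      then show ?thesis by (simp add: power_int_def)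
    qed
    have "\<rho> (pconst (lookup g \<alpha>) * (\<Prod>e\<in>I. chart_coord i j e ^ nat (lookup \<alpha> e + int (N e))))
        = \<rho> (pconst (lookup g \<alpha>)) * \<rho> (\<Prod>e\<in>I. chart_coord i j e ^ nat (lookup \<alpha> e + int (N e)))"
      by (intro mult chart_ring_pconst chart_ring_prod chart_ring_power mem)
    also have "\<dots> = v (lookup g \<alpha>) * (\<Prod>e\<in>I. w e ^ nat (lookup \<alpha> e + int (N e)))"
      by (simp add: prod chart_ring_power mem power w_def const)
    also have "\<dots> = q * (v (lookup g \<alpha>) * (\<Prod>e\<in>I. w e powi lookup \<alpha> e))"
      by (simp add: pow prod.distrib q_def mult_ac)
    also have "\<dots> \<le> q * B"
      using B(1)[OF \<alpha>] q by (simp add: w_def)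
    finally show "\<rho> (pconst (lookup g \<alpha>) *
      (\<Prod>e\<in>I. chart_coord i j e ^ nat (lookup \<alpha> e + int (N e)))) \<le> q * B" .
  qed (use q B(2) in simp)
  with q show ?thesis by simp
qed

end

section \<open>Extended logarithm and exponential\<close>

lemma eexp_elog: "0 \<le> a \<Longrightarrow> eexp (elog a) = a"
  by (simp add: eexp_def elog_def)

lemma elog_mult: "0 \<le> a \<Longrightarrow> 0 \<le> b \<Longrightarrow> elog (a * b) = elog a + elog b"
  by (simp add: elog_def ln_mult)

text \<open>For a = 0 and k > 0 both sides are -infinity; for k = 0 the convention 0 * (-infinity) =
  0 matches log 1 = 0. Negative k must be excluded there, since the right side would be
  +infinity.\<close>

lemma elog_powi:
  assumes "0 \<le> a" "a \<noteq> 0 \<or> 0 \<le> k"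
  shows "elog (a powi k) = ereal (of_int k) * elog a"
proof (cases "a = 0")
  case True
  with assms(2) show ?thesis by (cases "k = 0") (simp_all add: elog_def)
next
  case False
  with assms(1) have a: "0 < a" by simp
  have "ln (a powi k) = of_int k * ln a"
    using a by (simp add: power_int_def ln_realpow ln_inverse)
  with a show ?thesis by (simp add: elog_def)
qed

lemma elog_prod: "(\<And>e. e \<in> I \<Longrightarrow> 0 \<le> w e) \<Longrightarrow> elog (\<Prod>e\<in>I. w e) = (\<Sum>e\<in>I. elog (w e))"
proof (induction I rule: infinite_finite_induct)
  case (insert e I)
  then show ?case by (simp add: elog_mult prod_nonneg)
qed (simp_all add: elog_def zero_ereal_def)

text \<open>Turns the exponential in a term of the Gauss seminorm into a product of values
  \<rho>(u_e), once x_e - x_ij is log \<rho>(u_e). Passing through one logarithm of the whole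
  product also covers zero factors.\<close>

lemma eexp_sum_elog:
  assumes "\<And>e. e \<in> I \<Longrightarrow> 0 \<le> w e" "\<And>e. e \<in> I \<Longrightarrow> w e \<noteq> 0 \<or> 0 \<le> k e"
  shows "eexp (\<Sum>e\<in>I. ereal (of_int (k e)) * elog (w e)) = (\<Prod>e\<in>I. w e powi k e)"
proof -
  have "(\<Sum>e\<in>I. ereal (of_int (k e)) * elog (w e)) = elog (\<Prod>e\<in>I. w e powi k e)"
    using assms by (simp add: elog_prod elog_powi)
  then show ?thesis
    using assms by (simp add: eexp_elog prod_nonneg)
qed

section \<open>Laurent expansions for compatible index sets\<close>

lemma psubst_in_laurent_ring:
  assumes "f \<in> chart_ring n i j"
    and \<phi>: "\<And>e. e \<in> chart_pairs n i j \<Longrightarrow> \<phi> e \<in> laurent_ring I L"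
  shows "psubst \<phi> f \<in> laurent_ring I L"
  using assms(1)
  by (induction rule: chart_ring_induct)
    (simp_all add: psubst_pconst psubst_pvar laurent_ring_const \<phi> psubst.hom_add psubst.hom_mult
      laurent_ring_add laurent_ring_mult)

lemma laurent_eval_psubst:
  fixes f :: "'k::field pair_poly"
  assumes "f \<in> chart_ring n i j"
    and LR: "\<And>e. e \<in> chart_pairs n i j \<Longrightarrow> \<phi> e \<in> laurent_ring I L"
    and eval: "\<And>e. e \<in> chart_pairs n i j \<Longrightarrow> laurent_eval i j (\<phi> e) = to_fract (pvar e)"
    and L: "\<And>e. e \<in> L \<Longrightarrow> chart_coord i j e \<noteq> (0 :: 'k pair_poly)"
  shows "laurent_eval i j (psubst \<phi> f) = to_fract f"
proof -
  \<comment> \<open>Membership is carried along because multiplicativity of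
    \<open>laurent_eval\<close> is available only inside \<open>laurent_ring I L\<close>.\<close>
  have "psubst \<phi> f \<in> laurent_ring I L \<and> laurent_eval i j (psubst \<phi> f) = to_fract f"
    using assms(1)
  proof (induction rule: chart_ring_induct)
    case (const c)
    show ?case by (simp add: psubst_pconst laurent_ring_const laurent_eval_const)
  next
    case (var e)
    then show ?case by (simp add: psubst_pvar LR eval)
  next
    case (add f g)
    then show ?case
      by (simp add: psubst.hom_add laurent_ring_add laurent_eval_add to_fract.hom_add)
  next
    case (mult f g)
    have "laurent_eval i j (psubst \<phi> f * psubst \<phi> g)
        = laurent_eval i j (psubst \<phi> f) * laurent_eval i j (psubst \<phi> g)"
      using mult L by (intro laurent_eval_mult) blast+
    with mult show ?case
      by (simp add: psubst.hom_mult laurent_ring_mult to_fract.hom_mult)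
  qed
  then show ?thesis ..
qed

lemma finite_pairs: "finite (pairs n)"
proof (rule finite_subset)
  show "pairs n \<subseteq> (\<lambda>(k, l). Upair k l) ` ({1..n} \<times> {1..n})"
    unfolding pairs_def by force
qed simp

lemma trop_class_eqD:
  assumes "trop_class n x = trop_class n y"
  shows "\<exists>c::real. \<forall>e\<in>pairs n. x e = y e + ereal c"
proof -
  have "restrict (\<lambda>e. x e + ereal 0) (pairs n) \<in> trop_class n x"
    unfolding trop_class_def by blast
  then have "restrict (\<lambda>e. x e + ereal 0) (pairs n) \<in> trop_class n y"
    by (simp only: assms)
  then obtain c where c: "restrict (\<lambda>e. x e + ereal 0) (pairs n) = restrict (\<lambda>e. y e + ereal c) (pairs n)"
    unfolding trop_class_def by blast
  have "x e = y e + ereal c" if "e \<in> pairs n" for e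
    using fun_cong[OF c, of e] that by simp
  then show ?thesis by blast
qed

text \<open>Assigning to each \<open>k\<close> two elements of \<open>I\<close> as in cases (i)--(iii) of compatibility gives
  pairwise disjoint subsets, which exhaust \<open>I\<close> because \<^term>\<open>card I = 2 * (n - 2)\<close>.\<close>

lemma compatible_set_triangular:
  fixes n i j :: nat
  defines "N \<equiv> {1..n} - {i, j}"
  assumes i: "i \<in> {1..n}" and j: "j \<in> {1..n}" and ij: "i \<noteq> j" and T: "is_ltree n T"
    and po: "partial_order_on N r"
    and comp: "compatible_set n T i j r (J \<inter> chart_pairs n i j) I"
  defines "L \<equiv> I \<inter> chart_pairs n i j - J" and "R \<equiv> r - Id"
  shows "k \<in> N \<Longrightarrow>
      Upair i k \<in> I \<and> Upair j k \<in> I \<and> (\<forall>t\<in>N. (t, k) \<in> R \<longrightarrow> Upair k t \<notin> I) \<or>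
      Upair i k \<notin> I \<and> Upair j k \<in> I \<and>
        (\<exists>t\<in>N. (t, k) \<in> R \<and> Upair k t \<in> I \<and> Upair j t \<in> L \<and>
          (\<forall>s\<in>N. (s, k) \<in> R \<longrightarrow> Upair k s \<in> I \<longrightarrow> s = t)) \<or>
      Upair j k \<notin> I \<and> Upair i k \<in> I \<and>
        (\<exists>t\<in>N. (t, k) \<in> R \<and> Upair k t \<in> I \<and> Upair i t \<in> L \<and>
          (\<forall>s\<in>N. (s, k) \<in> R \<longrightarrow> Upair k s \<in> I \<longrightarrow> s = t))"
    and "e \<in> I \<Longrightarrow> (\<exists>k\<in>N. e = Upair i k \<or> e = Upair j k) \<or>
      (\<exists>k\<in>N. \<exists>t\<in>N. (t, k) \<in> R \<and> e = Upair k t)"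
proof -
  have I: "I \<subseteq> pairs n" "card I = 2 * (n - 2)"
    using comp unfolding compatible_set_def by blast+
  have fin: "finite I" using I(1) finite_pairs by (rule finite_subset)
  have notij: "k \<noteq> i" "k \<noteq> j" if "k \<in> N" for k
    using that by (simp_all add: N_def)
  have asym: "(k, t) \<notin> R" if "(t, k) \<in> R" for t k
    using po that unfolding partial_order_on_def antisym_def R_def by blast
  \<comment> \<open>The divisor u_bt is admissible: bt is in I because bl is for every l of the
    branch, and it avoids J by the choice of t.\<close>
  have omit: "Upair b k \<in> I \<and> (\<exists>t\<in>N. (t, k) \<in> R \<and> Upair k t \<in> I \<and> Upair b t \<in> L)"
    if "compatible_omit a b r (J \<inter> chart_pairs n i j) I B k" "{a, b} = {i, j}" "k \<in> B" "B \<subseteq> N" for a b B k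
  proof -
    from that(1) obtain t where t: "t \<in> B" "strictly_below r t k" "Upair b t \<notin> J \<inter> chart_pairs n i j"
        "Upair k t \<in> I" and all: "\<forall>l\<in>B. Upair b l \<in> I"
      unfolding compatible_omit_def Let_def by blast
    have "b = i \<or> b = j" using that(2) by blast
    then have "Upair b t \<in> chart_pairs n i j"
      using t(1) that(4) unfolding chart_pairs_def N_def by blast
    then have "Upair b t \<in> L" using t all unfolding L_def by blast
    then show ?thesis using t all that(3,4) unfolding R_def by blast
  qed
  \<comment> \<open>E consists of the two members of I charged to k: both chart coordinates, or one
    of them and the u_kt that replaces the other.\<close>
  define Q where "Q k E \<longleftrightarrow> E \<subseteq> I \<and> card E = 2 \<and>
    (Upair i k \<in> I \<and> Upair j k \<in> I \<and> E = {Upair i k, Upair j k} \<or>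
     Upair i k \<notin> I \<and> Upair j k \<in> I \<and>
       (\<exists>t\<in>N. (t, k) \<in> R \<and> Upair k t \<in> I \<and> Upair j t \<in> L \<and> E = {Upair j k, Upair k t}) \<or>
     Upair j k \<notin> I \<and> Upair i k \<in> I \<and>
       (\<exists>t\<in>N. (t, k) \<in> R \<and> Upair k t \<in> I \<and> Upair i t \<in> L \<and> E = {Upair i k, Upair k t}))"
    for k E
  have card2: "card {Upair b k, Upair k t} = 2" if "t \<noteq> b" for b k t :: nat
    using that by auto
  have "\<exists>E. Q k E" if k: "k \<in> N" for k
  proof -
    obtain a where a: "a \<in> internal_verts T i j" and ka: "k \<in> branch n T i j a"
      using branches_cover[OF T i j ij] k unfolding N_def by blast
    let ?B = "branch n T i j a"
    have B: "?B \<subseteq> N" unfolding branch_def N_def by blast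
    from comp a ka consider
        (both) "compatible_both i j r (J \<inter> chart_pairs n i j) I k"
      | (omit_i) "compatible_omit i j r (J \<inter> chart_pairs n i j) I ?B k"
      | (omit_j) "compatible_omit j i r (J \<inter> chart_pairs n i j) I ?B k"
      unfolding compatible_set_def Let_def by blast
    then show ?thesis
    proof cases
      case both
      then have "Upair i k \<in> I" "Upair j k \<in> I"
        unfolding compatible_both_def by blast+
      moreover have "card {Upair i k, Upair j k} = 2"
        using ij by auto
      ultimately show ?thesis
        unfolding Q_def by (intro exI[of _ "{Upair i k, Upair j k}"]) blast
    next
      case omit_i
      from omit[OF this refl ka B] obtain t where t: "Upair j k \<in> I" "t \<in> N" "(t, k) \<in> R"
        "Upair k t \<in> I" "Upair j t \<in> L" by blast
      moreover have "Upair i k \<notin> I"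
        using omit_i unfolding compatible_omit_def by blast
      ultimately show ?thesis
        using card2[OF notij(2)[OF t(2)]]
        unfolding Q_def by (intro exI[of _ "{Upair j k, Upair k t}"]) blast
    next
      case omit_j
      from omit[OF this insert_commute ka B] obtain t where t: "Upair i k \<in> I" "t \<in> N" "(t, k) \<in> R"
        "Upair k t \<in> I" "Upair i t \<in> L" by blast
      moreover have "Upair j k \<notin> I"
        using omit_j unfolding compatible_omit_def by blast
      ultimately show ?thesis
        using card2[OF notij(1)[OF t(2)]]
        unfolding Q_def by (intro exI[of _ "{Upair i k, Upair k t}"]) blast
    qed
  qed
  then obtain E where E: "Q k (E k)" if "k \<in> N" for k by metis
  have shape: "e = Upair i k \<or> e = Upair j k \<or> (\<exists>t\<in>N. (t, k) \<in> R \<and> e = Upair k t)"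
    if "k \<in> N" "e \<in> E k" for k e
    using E[OF that(1)] that(2) unfolding Q_def by blast
  \<comment> \<open>A pair kt charged to both k and t would need t below k and k below t; a pair
    through i or j determines its leaf.\<close>
  have disj: "E k \<inter> E l = {}" if k: "k \<in> N" and l: "l \<in> N" and kl: "k \<noteq> l" for k l
  proof -
    have False if "e \<in> E k" "e \<in> E l" for e
    proof -
      have "(\<exists>b\<in>{i, j}. e = Upair b k) \<or> (\<exists>t\<in>N. (t, k) \<in> R \<and> e = Upair k t)"
        "(\<exists>c\<in>{i, j}. e = Upair c l) \<or> (\<exists>s\<in>N. (s, l) \<in> R \<and> e = Upair l s)"
        using shape[OF k that(1)] shape[OF l that(2)] by blast+
      then show False
      proof (elim disjE bexE conjE)
        fix b c assume "b \<in> {i, j}" "e = Upair b k" "c \<in> {i, j}" "e = Upair c l"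
        then show False using kl notij[OF k] notij[OF l] by auto
      next
        fix b s assume "b \<in> {i, j}" "e = Upair b k" "s \<in> N" "e = Upair l s"
        then show False using kl notij[OF l] notij[of s] by auto
      next
        fix t c assume "t \<in> N" "e = Upair k t" "c \<in> {i, j}" "e = Upair c l"
        then show False using kl notij[OF k] notij[of t] by auto
      next
        fix t s assume t: "(t, k) \<in> R" "e = Upair k t" and s: "(s, l) \<in> R" "e = Upair l s"
        with kl have "t = l" "s = k" by auto
        with t(1) s(1) asym[of k l] show False by simp
      qed
    qed
    then show ?thesis by blast
  qed
  \<comment> \<open>Together the disjoint sets E k have 2(n - 2) elements, as many as I, so nothing
    in I is left over.\<close>
  have "card (\<Union>k\<in>N. E k) = (\<Sum>k\<in>N. card (E k))"
    using E disj finite_subset[OF _ fin] unfolding Q_def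
    by (intro card_UN_disjoint) (simp_all add: N_def)
  also have "\<dots> = 2 * card N"
    using E unfolding Q_def by simp
  also have "\<dots> = card I"
    using i j ij I(2) by (simp add: N_def card_Diff_subset)
  finally have "(\<Union>k\<in>N. E k) = I"
    using E unfolding Q_def by (intro card_subset_eq fin) blast+
  then have cover: "\<exists>k\<in>N. e \<in> E k" if "e \<in> I" for e
    using that by blast
  show "(\<exists>k\<in>N. e = Upair i k \<or> e = Upair j k) \<or>
      (\<exists>k\<in>N. \<exists>t\<in>N. (t, k) \<in> R \<and> e = Upair k t)" if "e \<in> I" for e
    using cover[OF that] shape by blast
  \<comment> \<open>A pair kt in I with t below k is charged to k and not to t. As E k contains at
    most one such pair, t is unique.\<close>
  have own: "Upair k t \<in> E k" if k: "k \<in> N" and t: "t \<in> N" "(t, k) \<in> R" "Upair k t \<in> I" for k t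
  proof -
    from cover[OF t(3)] obtain l where l: "l \<in> N" "Upair k t \<in> E l" by blast
    have "Upair k t \<noteq> Upair i l" "Upair k t \<noteq> Upair j l"
      using notij[OF k] notij[OF t(1)] by auto
    with shape[OF l] obtain s where s: "(s, l) \<in> R" "Upair k t = Upair l s" by blast
    then have "l = k \<or> l = t \<and> s = k" by auto
    with s(1) asym[OF t(2)] l(2) show ?thesis by blast
  qed
  show "Upair i k \<in> I \<and> Upair j k \<in> I \<and> (\<forall>t\<in>N. (t, k) \<in> R \<longrightarrow> Upair k t \<notin> I) \<or>
      Upair i k \<notin> I \<and> Upair j k \<in> I \<and>
        (\<exists>t\<in>N. (t, k) \<in> R \<and> Upair k t \<in> I \<and> Upair j t \<in> L \<and>
          (\<forall>s\<in>N. (s, k) \<in> R \<longrightarrow> Upair k s \<in> I \<longrightarrow> s = t)) \<or>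
      Upair j k \<notin> I \<and> Upair i k \<in> I \<and>
        (\<exists>t\<in>N. (t, k) \<in> R \<and> Upair k t \<in> I \<and> Upair i t \<in> L \<and>
          (\<forall>s\<in>N. (s, k) \<in> R \<longrightarrow> Upair k s \<in> I \<longrightarrow> s = t))" if k: "k \<in> N" for k
  proof -
    have new: "Upair k s \<noteq> Upair i k" "Upair k s \<noteq> Upair j k" if "s \<in> N" for s
      using notij[OF k] notij[OF that] by auto
    have inj: "s = t" if "s \<in> N" "(s, k) \<in> R" "Upair k s \<in> I" "E k = {Upair b k, Upair k t}" "b \<in> {i, j}"
      for s t b
      using own[OF k that(1-3)] new[OF that(1)] that(4,5) by auto
    from E[OF k] consider
        (both) "Upair i k \<in> I" "Upair j k \<in> I" "E k = {Upair i k, Upair j k}"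
      | (omit_i) t where "Upair i k \<notin> I" "Upair j k \<in> I" "t \<in> N" "(t, k) \<in> R" "Upair k t \<in> I"
          "Upair j t \<in> L" "E k = {Upair j k, Upair k t}"
      | (omit_j) t where "Upair j k \<notin> I" "Upair i k \<in> I" "t \<in> N" "(t, k) \<in> R" "Upair k t \<in> I"
          "Upair i t \<in> L" "E k = {Upair i k, Upair k t}"
      unfolding Q_def by blast
    then show ?thesis
    proof cases
      case both
      then have "\<forall>t\<in>N. (t, k) \<in> R \<longrightarrow> Upair k t \<notin> I"
        using own[OF k] new by blast
      with both show ?thesis by blast
    next
      case omit_i
      then have "\<forall>s\<in>N. (s, k) \<in> R \<longrightarrow> Upair k s \<in> I \<longrightarrow> s = t"
        using inj[of _ j t] by blast
      with omit_i show ?thesis by blast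
    next
      case omit_j
      then have "\<forall>s\<in>N. (s, k) \<in> R \<longrightarrow> Upair k s \<in> I \<longrightarrow> s = t"
        using inj[of _ i t] by blast
      with omit_j show ?thesis by blast
    qed
  qed
qed

theorem lemma4p17:
  fixes v :: "'k::field \<Rightarrow> real"
    and n i j :: nat
    and x :: "nat uprod \<Rightarrow> ereal"
    and T :: "'v ltree"
    and I J :: "nat uprod set"
    and r :: "nat rel"
    and \<rho> :: "'k pair_poly \<Rightarrow> real"
  assumes "complete_nonarch_abs v"
    and "i \<in> {1..n}" and "j \<in> {1..n}" and "i \<noteq> j"
    and "trop_class n x \<in> trop_Gr v n"
    and "trop_class n x \<in> trop_U v n i j"
    and "is_ltree n T"
    and "vanishing_set v n T i j J"
    and "trop_class n x \<in> stratum v n T i j J"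
    and "partial_order_on ({1..n} - {i, j}) r"
    and "cherry_property n T i j r"
    and "compatible_set n T i j r (J \<inter> chart_pairs n i j) I"
    and "\<rho> \<in> trop_fibre v n i j (trop_class n x)"
  shows "\<forall>f \<in> chart_ring n i j. \<rho> f \<le> chart_section v n i j I J x f"
proof
  fix f :: "'k pair_poly" assume f: "f \<in> chart_ring n i j"
  define L where "L = I \<inter> chart_pairs n i j - J"
  define w where "w e = \<rho> (chart_coord i j e)" for e
  have "\<rho> \<in> chart_an v n i j" and trop: "trop_class n (\<lambda>e. elog (w e)) = trop_class n x"
    using assms(13) by (simp_all add: trop_fibre_def trop_map_def w_def)
  interpret chart_seminorm v n i j \<rho>
    by unfold_locales fact+
  have I: "I \<subseteq> pairs n"
    using assms(12) unfolding compatible_set_def by blast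
  have fin: "finite I" using I finite_pairs by (rule finite_subset)
  have mem: "chart_coord i j e \<in> (chart_ring n i j :: 'k pair_poly set)" if "e \<in> I" for e
    using chart_coord_in_chart_ring[OF assms(2,3)] I that by blast
  \<comment> \<open>The vector x matches the logarithms of \<rho> only up to a constant c. Since
    \<rho> is 1 on u_ij, c equals -x_ij, so the differences x_e - x_ij are the logarithms
    themselves.\<close>
  obtain c :: real where c: "\<forall>e\<in>pairs n. elog (w e) = x e + ereal c"
    using trop_class_eqD[OF trop] by blast
  have ijn: "Upair i j \<in> pairs n"
    using assms(2-4) unfolding pairs_def by blast
  have "w (Upair i j) = 1"
    by (simp add: w_def chart_coord_def one)
  then have "x (Upair i j) + ereal c = 0"
    using c ijn by (metis elog_def ln_one one_neq_zero zero_ereal_def)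
  then have xij: "x (Upair i j) = ereal (- c)"
    by (cases "x (Upair i j)") (auto simp: zero_ereal_def)
  have x: "x e - x (Upair i j) = elog (w e)" if "e \<in> I" for e
  proof -
    have "x e - x (Upair i j) = x e + ereal c"
      unfolding xij by (cases "x e") simp_all
    then show ?thesis using c I that by auto
  qed
  \<comment> \<open>\<open>stratum\<close> describes J through some representative y of the class;
    it differs from x by a finite constant, which preserves -infinity.\<close>
  have L_w: "w e \<noteq> 0" if "e \<in> L" for e
  proof
    assume "w e = 0"
    from that have e: "e \<in> chart_pairs n i j" "e \<notin> J" "e \<in> pairs n"
      using I unfolding L_def by blast+
    from assms(9) obtain y where y: "trop_class n x = trop_class n y"
      "\<forall>e\<in>chart_pairs n i j. y e = -\<infinity> \<longleftrightarrow> e \<in> J"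
      unfolding stratum_def by blast
    obtain d :: real where d: "\<forall>e\<in>pairs n. x e = y e + ereal d"
      using trop_class_eqD[OF y(1)] by blast
    have "elog (w e) = y e + ereal d + ereal c"
      using c d e(3) by simp
    with \<open>w e = 0\<close> have "y e = -\<infinity>"
      by (cases "y e") (simp_all add: elog_def)
    with y(2) e(1,2) show False by blast
  qed
  have L: "chart_coord i j e \<noteq> (0 :: 'k pair_poly)" if "e \<in> L" for e
    using L_w[OF that] zero by (auto simp: w_def)
  have N: "finite r"
    using assms(10) finite_subset[of r "({1..n} - {i, j}) \<times> ({1..n} - {i, j})"]
    unfolding partial_order_on_def preorder_on_def by blast
  \<comment> \<open>The recursion that produces \<phi> runs along the strict part of the order,
    well-founded by finiteness.\<close>
  have "wf (r - Id)"
    using N assms(10) by (intro finite_acyclic_wf partial_order_on_acyclic) simp_all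
  from chart_inverse_exists[OF assms(4) this, of L I n,
      OF _ _ compatible_set_triangular(1)[OF assms(2-4,7,10,12), folded L_def]
         compatible_set_triangular(2)[OF assms(2-4,7,10,12)]]
  obtain \<phi> :: "nat uprod \<Rightarrow> 'k pair_laurent" where
    \<phi>: "\<And>e. e \<in> chart_pairs n i j \<Longrightarrow> \<phi> e \<in> laurent_ring I L"
      "\<And>e. e \<in> chart_pairs n i j \<Longrightarrow> laurent_eval i j (\<phi> e) = to_fract (pvar e)"
      "\<And>e. e \<in> I \<Longrightarrow> psubst \<phi> (chart_coord i j e) = single (single e 1) 1"
    unfolding L_def by blast
  define g where "g = psubst \<phi> f"
  have g: "g \<in> laurent_ring I L" "laurent_eval i j g = to_fract f"
    unfolding g_def using psubst_in_laurent_ring[OF f \<phi>(1)] laurent_eval_psubst[OF f \<phi>(1,2) L]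
    by simp_all
  have "(THE g. g \<in> laurent_ring I L \<and> laurent_eval i j g = to_fract f) = g"
  proof (rule the_equality)
    show "h = g" if "h \<in> laurent_ring I L \<and> laurent_eval i j h = to_fract f" for h
      unfolding g_def using that by (intro laurent_expansion_unique[OF fin _ L _ \<phi>(3)]) simp_all
  qed (use g in simp)
  then have sec: "chart_section v n i j I J x f = gauss_seminorm v i j I x g"
    by (simp add: chart_section_def L_def)
  show "\<rho> f \<le> chart_section v n i j I J x f"
    unfolding sec
  proof (rule le_laurent_bound[OF fin g(1) f g(2) mem])
    show "\<rho> (chart_coord i j e) \<noteq> 0" if "e \<in> L" for e
      using L_w[OF that] by (simp add: w_def)
    show "0 \<le> gauss_seminorm v i j I x g"
      unfolding gauss_seminorm_def by (intro Max_ge) simp_all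
    fix \<alpha> assume \<alpha>: "\<alpha> \<in> keys g"
    have "eexp (\<Sum>e\<in>I. ereal (of_int (lookup \<alpha> e)) * (x e - x (Upair i j)))
        = eexp (\<Sum>e\<in>I. ereal (of_int (lookup \<alpha> e)) * elog (w e))"
      by (simp add: x)
    also have "\<dots> = (\<Prod>e\<in>I. w e powi lookup \<alpha> e)"
    proof (rule eexp_sum_elog)
      show "0 \<le> w e" if "e \<in> I" for e
        using nonneg[OF mem[OF that]] by (simp add: w_def)
      \<comment> \<open>Negative exponents occur only on L, where \<rho>(u_e) is nonzero.\<close>
      show "w e \<noteq> 0 \<or> 0 \<le> lookup \<alpha> e" for e
        using L_w[of e] g(1) \<alpha> unfolding laurent_ring_def by blast
    qed
    finally have "v (lookup g \<alpha>) * (\<Prod>e\<in>I. w e powi lookup \<alpha> e) = v (lookup g \<alpha>) *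
        eexp (\<Sum>e\<in>I. ereal (of_int (lookup \<alpha> e)) * (x e - x (Upair i j)))"
      by simp
    also have "\<dots> \<le> gauss_seminorm v i j I x g"
      unfolding gauss_seminorm_def using \<alpha> by (intro Max_ge) simp_all
    finally show "v (lookup g \<alpha>) * (\<Prod>e\<in>I. \<rho> (chart_coord i j e) powi lookup \<alpha> e)
        \<le> gauss_seminorm v i j I x g"
      by (simp add: w_def)
  qed
qed

end
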